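(* Let $G$ be a cycle with root $r$ and edge weights $\gamma,\tau:E(G)\to\mathbb{R}$, and let $e_1\in E(G)$ be such that $T_1=G-e_1$ is a cable-trench tree of $G$. Let $v_1,\dots,v_n$ be distinct vertices of $G$ with $v_i\neq r$, and for each $i$ let $H_{v_i}$ be a graph with root $r_{H_{v_i}}$, edge weights $\gamma,\tau$, and cable-trench tree $S_i$. Form the wedge $G\wedge H_{v_1}\wedge\dots\wedge H_{v_n}$ by identifying each $v_i$ with $r_{H_{v_i}}$ (the $H_{v_i}$ otherwise vertex-disjoint from $G$ and from each other), rooted at $r$, with inherited weights. Suppose that for every edge $e_2\in E(G)$ with $e_2\neq e_1$, $$0\geq \tau(e_2)-\tau(e_1)+L(P_2)-L(P_1)+\big(L(P_2)-L(P_1)\big)|\tilde Q|+C(\tilde Q^+)-C(\tilde Q^-)+\sum_{v\in H(\tilde Q)}\big(L(R_1^{(v)})-L(R_2^{(v)})\big)|H_v|,$$ where all quantities are defined (depending on $e_2$) in the context. Then $T_1\wedge S_1\wedge\dots\wedge S_n$ is a cable-trench tree of $G\wedge H_{v_1}\wedge\dots\wedge H_{v_n}$.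
   Context: For a connected rooted graph with root $r$ and edge weights $\gamma,\tau$, the cost of a spanning tree $T$ is $\mathrm{cost}(T)=\sum_{e\in E(T)}\tau(e)+\sum_{w}\sum_{e\in P_T(r,w)}\gamma(e)$, where $P_T(r,w)$ is the unique $r$–$w$ path in $T$; a cable-trench tree is a spanning tree of minimum cost. For spanning trees $T$ of $G$ and $S_i$ of $H_{v_i}$, $T\wedge S_1\wedge\dots\wedge S_n$ denotes the spanning tree of the wedge with edge set $E(T)\cup\bigcup_i E(S_i)$. For a path $P$ with edges $(f_1,\dots,f_k)$ listed in order of traversal, $|P|=k$, $L(P)=\sum_{i=1}^k\gamma(f_i)$ and $C(P)=\sum_{i=1}^k\sum_{j=1}^i\gamma(f_j)$. Given distinct $e_1,e_2\in E(G)$: deleting $e_1,e_2$ from the cycle leaves two paths; let $\tilde Q$ be the one not containing $r$ (possibly a single vertex). $P_1$ is the path starting at $r$ and running along the cycle, in the direction in which $e_1$ is met before $e_2$, up to and including $e_1$; $P_2$ is defined symmetrically with $e_2$. $\tilde Q^+$ is $\tilde Q$ traversed from its endpoint incident to $e_2$ to its endpoint incident to $e_1$, and $\tilde Q^-$ is the reverse traversal. For $i=1,2$ and a vertex $v\neq r$ of $G$, $R_i^{(v)}$ is the $r$–$v$ path in $G$ not containing $e_i$, oriented from $r$. $H(\tilde Q)$ is the set of wedge vertices $v_j$ lying on $\tilde Q$, and for $v=v_j$, $H_v=H_{v_j}$ and $|H_v|=|V(H_{v_j})|-1$ (the number of vertices of $H_{v_j}$ other than its root). *)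

theory Defs
  imports Complex_Main
begin

text \<open>
  Rooted, edge-weighted undirected graphs. Edges are abstract objects, and \<open>ends e\<close> is the set of
  endpoints of \<open>e\<close>, so parallel edges and loops are allowed; simple graphs are the special case
  where \<open>ends\<close> is injective on the edges and only takes two-element values.
\<close>

record ('v, 'e) rgraph =
  verts :: "'v set"
  edges :: "'e set"
  ends :: "'e \<Rightarrow> 'v set"
  groot :: "'v"
  \<gamma> :: "'e \<Rightarrow> real"
  \<tau> :: "'e \<Rightarrow> real"

definition rooted_graph :: "('v, 'e) rgraph \<Rightarrow> bool" where
  "rooted_graph G \<longleftrightarrow>
     finite (verts G) \<and> finite (edges G) \<and> groot G \<in> verts G \<and>
     (\<forall>e\<in>edges G. \<exists>x\<in>verts G. \<exists>y\<in>verts G. ends G e = {x, y})"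

definition delete_edges :: "('v, 'e) rgraph \<Rightarrow> 'e set \<Rightarrow> ('v, 'e) rgraph" where
  "delete_edges G D = G\<lparr>edges := edges G - D\<rparr>"

text \<open>A path is given by its list of edges in order of traversal; \<open>xs\<close> is the list of its vertices.\<close>

definition path :: "('v, 'e) rgraph \<Rightarrow> 'v \<Rightarrow> 'e list \<Rightarrow> 'v \<Rightarrow> bool" where
  "path G u p w \<longleftrightarrow>
     (\<exists>xs. length xs = Suc (length p) \<and> hd xs = u \<and> last xs = w \<and> distinct xs \<and>
        set xs \<subseteq> verts G \<and> set p \<subseteq> edges G \<and>
        (\<forall>i<length p. ends G (p ! i) = {xs ! i, xs ! Suc i}))"

definition cycle_in :: "('v, 'e) rgraph \<Rightarrow> 'v list \<Rightarrow> 'e list \<Rightarrow> bool" where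
  "cycle_in G xs fs \<longleftrightarrow>
     xs \<noteq> [] \<and> length fs = length xs \<and> distinct xs \<and> distinct fs \<and>
     set xs \<subseteq> verts G \<and> set fs \<subseteq> edges G \<and>
     (\<forall>i<length xs. ends G (fs ! i) = {xs ! i, xs ! (Suc i mod length xs)})"

definition cycle_graph :: "('v, 'e) rgraph \<Rightarrow> bool" where
  "cycle_graph G \<longleftrightarrow> (\<exists>xs fs. cycle_in G xs fs \<and> verts G = set xs \<and> edges G = set fs)"

definition connected_graph :: "('v, 'e) rgraph \<Rightarrow> bool" where
  "connected_graph G \<longleftrightarrow> (\<forall>u\<in>verts G. \<forall>w\<in>verts G. \<exists>p. path G u p w)"

definition tree :: "('v, 'e) rgraph \<Rightarrow> bool" where
  "tree G \<longleftrightarrow> connected_graph G \<and> \<not> (\<exists>xs fs. cycle_in G xs fs)"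

text \<open>Spanning trees are represented by their edge sets.\<close>

definition spanning_tree :: "('v, 'e) rgraph \<Rightarrow> 'e set \<Rightarrow> bool" where
  "spanning_tree G T \<longleftrightarrow> T \<subseteq> edges G \<and> tree (G\<lparr>edges := T\<rparr>)"

definition L :: "('v, 'e) rgraph \<Rightarrow> 'e list \<Rightarrow> real" where
  "L G p = (\<Sum>i<length p. \<gamma> G (p ! i))"

definition C :: "('v, 'e) rgraph \<Rightarrow> 'e list \<Rightarrow> real" where
  "C G p = (\<Sum>i<length p. \<Sum>j\<le>i. \<gamma> G (p ! j))"

definition tree_path :: "('v, 'e) rgraph \<Rightarrow> 'e set \<Rightarrow> 'v \<Rightarrow> 'e list" where
  "tree_path G T w = (THE p. path (G\<lparr>edges := T\<rparr>) (groot G) p w)"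

definition cost :: "('v, 'e) rgraph \<Rightarrow> 'e set \<Rightarrow> real" where
  "cost G T = (\<Sum>e\<in>T. \<tau> G e) + (\<Sum>w\<in>verts G. \<Sum>e\<in>set (tree_path G T w). \<gamma> G e)"

definition cable_trench_tree :: "('v, 'e) rgraph \<Rightarrow> 'e set \<Rightarrow> bool" where
  "cable_trench_tree G T \<longleftrightarrow>
     spanning_tree G T \<and> (\<forall>T'. spanning_tree G T' \<longrightarrow> cost G T \<le> cost G T')"

text \<open>
  The wedge of \<open>G\<close> with \<open>H 1, \<dots>, H n\<close> at the vertices \<open>v 1, \<dots>, v n\<close>, built on disjoint sums:
  \<open>wedge_emb\<close> sends the root of \<open>H i\<close> to \<open>v i\<close> and every other vertex of \<open>H i\<close> to a fresh copy.
\<close>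

definition wedge_emb ::
  "(nat \<Rightarrow> 'v) \<Rightarrow> (nat \<Rightarrow> ('w, 'f) rgraph) \<Rightarrow> nat \<Rightarrow> 'w \<Rightarrow> 'v + nat \<times> 'w" where
  "wedge_emb v H i x = (if x = groot (H i) then Inl (v i) else Inr (i, x))"

definition wedge_edges :: "nat \<Rightarrow> 'e set \<Rightarrow> (nat \<Rightarrow> 'f set) \<Rightarrow> ('e + nat \<times> 'f) set" where
  "wedge_edges n T S = Inl ` T \<union> (\<Union>i\<in>{1..n}. (\<lambda>f. Inr (i, f)) ` S i)"

definition wedge ::
  "nat \<Rightarrow> ('v, 'e) rgraph \<Rightarrow> (nat \<Rightarrow> 'v) \<Rightarrow> (nat \<Rightarrow> ('w, 'f) rgraph)
     \<Rightarrow> ('v + nat \<times> 'w, 'e + nat \<times> 'f) rgraph" where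
  "wedge n G v H =
     \<lparr>verts = Inl ` verts G \<union> (\<Union>i\<in>{1..n}. wedge_emb v H i ` verts (H i)),
      edges = wedge_edges n (edges G) (\<lambda>i. edges (H i)),
      ends = case_sum (\<lambda>e. Inl ` ends G e) (\<lambda>(i, f). wedge_emb v H i ` ends (H i) f),
      groot = Inl (groot G),
      \<gamma> = case_sum (\<gamma> G) (\<lambda>(i, f). \<gamma> (H i) f),
      \<tau> = case_sum (\<tau> G) (\<lambda>(i, f). \<tau> (H i) f)\<rparr>"

text \<open>
  The remaining definitions are meant for a cycle \<open>G\<close> and two distinct edges of it.
  \<open>arm G e e'\<close> is the path from the root that ends with \<open>e\<close> and runs in the direction in which
  \<open>e\<close> is met before \<open>e'\<close>; thus \<open>P\<^sub>1 = arm G e\<^sub>1 e\<^sub>2\<close> and \<open>P\<^sub>2 = arm G e\<^sub>2 e\<^sub>1\<close>.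
\<close>

definition arm :: "('v, 'e) rgraph \<Rightarrow> 'e \<Rightarrow> 'e \<Rightarrow> 'e list" where
  "arm G e e' = (THE p. p \<noteq> [] \<and> last p = e \<and> e' \<notin> set p \<and> (\<exists>w. path G (groot G) p w))"

text \<open>The vertices of \<open>Q\<close>, the component of \<open>G - e\<^sub>1 - e\<^sub>2\<close> that does not contain the root.\<close>

definition Q_verts :: "('v, 'e) rgraph \<Rightarrow> 'e \<Rightarrow> 'e \<Rightarrow> 'v set" where
  "Q_verts G e1 e2 =
     {w \<in> verts G. \<not> (\<exists>p. path (delete_edges G {e1, e2}) (groot G) p w)}"

definition Q_plus :: "('v, 'e) rgraph \<Rightarrow> 'e \<Rightarrow> 'e \<Rightarrow> 'e list" where
  "Q_plus G e1 e2 =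
     (THE q. \<exists>x \<in> Q_verts G e1 e2 \<inter> ends G e2. \<exists>y \<in> Q_verts G e1 e2 \<inter> ends G e1.
        path (delete_edges G {e1, e2}) x q y)"

definition Q_minus :: "('v, 'e) rgraph \<Rightarrow> 'e \<Rightarrow> 'e \<Rightarrow> 'e list" where
  "Q_minus G e1 e2 = rev (Q_plus G e1 e2)"

text \<open>\<open>R\<^sub>i\<close> is \<open>path_avoiding G e\<^sub>i\<close>.\<close>

definition path_avoiding :: "('v, 'e) rgraph \<Rightarrow> 'e \<Rightarrow> 'v \<Rightarrow> 'e list" where
  "path_avoiding G e w = (THE p. path G (groot G) p w \<and> e \<notin> set p)"

end

(* Every spanning tree of the wedge is a union of a spanning tree of G and spanning trees of the
   H_i, because the wedge retracts onto G and onto each H_i. Its cost is the sum of the costs of the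
   pieces plus (|V(H_i)| - 1) times the gamma-distance from r to v_i in the tree of G, so the H_i can
   be optimised separately and only the spanning trees G - e of the cycle remain. Passing from G - e2
   to G - e1 changes the distances only on Q: with Q+ as q, the k-th vertex of Q has distance
   L(P2) + L(take k q) in the latter and L(P1) + L(drop k q) in the former. Summing over Q shows that
   the right-hand side of the hypothesis is exactly the difference of the costs of the two wedge
   trees. *)
theory Submission
  imports Defs
begin

section \<open>Paths, reachability and uniqueness of paths in forests\<close>

text \<open>\<open>path\<close> and \<open>cycle_in\<close> insist on distinct vertices, and a
  retraction destroys this by collapsing edges. Connectedness and acyclicity are therefore restated
  through the reflexive transitive closure of \<open>adj\<close>: every vertex is reachable from the
  root, and every edge is a bridge. Both conditions can be carried along embeddings and retractions;
  edge lists are needed again only to evaluate distances. The paths in the hypothesis are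
  \<open>THE\<close> terms, so each one has to be identified by uniqueness of paths in a forest. On
  the cycle a single invariant does all the separating: without the edges at positions
  \<open>a < b\<close>, no walk leaves the vertices at positions \<open>a + 1\<close> to
  \<open>b\<close>, and the root at position 0 is not among them. It yields the bridges of
  \<open>G - e\<close>, the fact that a spanning tree misses exactly one edge, and the vertex set of
  Q.\<close>

definition path_via :: "('v, 'e) rgraph \<Rightarrow> 'v list \<Rightarrow> 'e list \<Rightarrow> bool" where
  "path_via G xs p \<longleftrightarrow> length xs = Suc (length p) \<and> distinct xs \<and>
     set xs \<subseteq> verts G \<and> set p \<subseteq> edges G \<and>
     (\<forall>i<length p. ends G (p ! i) = {xs ! i, xs ! Suc i})"

lemma path_iff_via: "path G u p w \<longleftrightarrow> (\<exists>xs. path_via G xs p \<and> hd xs = u \<and> last xs = w)"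
  unfolding path_def path_via_def by blast

lemma path_viaD:
  assumes "path_via G xs p"
  shows "length xs = Suc (length p)" "xs \<noteq> []" "distinct xs" "set xs \<subseteq> verts G" "set p \<subseteq> edges G"
  using assms by (auto simp: path_via_def)

lemma path_via_Nil [simp]: "path_via G xs [] \<longleftrightarrow> (\<exists>x\<in>verts G. xs = [x])"
  by (auto simp: path_via_def length_Suc_conv)

lemma path_via_Cons:
  "path_via G (x # xs) (e # p) \<longleftrightarrow> x \<in> verts G \<and> x \<notin> set xs \<and> e \<in> edges G \<and>
     ends G e = {x, hd xs} \<and> path_via G xs p"
proof -
  have "(\<forall>i<Suc (length p). ends G ((e # p) ! i) = {(x # xs) ! i, xs ! i}) \<longleftrightarrow>
     ends G e = {x, xs ! 0} \<and> (\<forall>i<length p. ends G (p ! i) = {xs ! i, xs ! Suc i})"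
    by (auto simp: less_Suc_eq_0_disj)
  then show ?thesis
    by (cases xs) (auto simp: path_via_def)
qed

lemma path_via_ConsE:
  assumes "path_via G ys (e # p)"
  obtains x xs where "ys = x # xs" "x \<in> verts G" "x \<notin> set xs" "e \<in> edges G"
    "ends G e = {x, hd xs}" "path_via G xs p" "xs \<noteq> []"
proof (cases ys)
  case Nil
  with assms show ?thesis by (simp add: path_via_def)
next
  case (Cons x xs)
  then show ?thesis using assms that path_viaD(2) by (metis path_via_Cons)
qed

lemma path_via_rev: "path_via G xs p \<Longrightarrow> path_via G (rev xs) (rev p)"
  unfolding path_via_def
  by (auto simp: rev_nth Suc_diff_Suc insert_commute)

lemma path_via_append:
  assumes "path_via G xs p" "path_via G (y # ys) q" "last xs = y" "set xs \<inter> set ys = {}"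
  shows "path_via G (xs @ ys) (p @ q)"
  using assms
proof (induction p arbitrary: xs)
  case Nil
  then show ?case by auto
next
  case (Cons e p)
  from Cons.prems(1) show ?case
  proof (rule path_via_ConsE)
    fix x xs'
    assume *: "xs = x # xs'" "x \<in> verts G" "x \<notin> set xs'" "e \<in> edges G"
      "ends G e = {x, hd xs'}" "path_via G xs' p" "xs' \<noteq> []"
    with Cons.IH[of xs'] Cons.prems show ?thesis
      by (auto simp: path_via_Cons)
  qed
qed

lemma path_via_take:
  assumes "path_via G xs p" "k \<le> length p"
  shows "path_via G (take (Suc k) xs) (take k p)"
  using assms unfolding path_via_def by (auto dest: in_set_takeD)

lemma path_via_drop:
  assumes "path_via G xs p" "k \<le> length p"
  shows "path_via G (drop k xs) (drop k p)"
  using assms unfolding path_via_def by (auto dest: in_set_dropD)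

lemma path_via_ends: "path_via G xs p \<Longrightarrow> e \<in> set p \<Longrightarrow> ends G e \<subseteq> set xs"
  by (auto simp: path_via_def in_set_conv_nth[of e])

text \<open>Distinct vertices force distinct edges: the first edge contains the first vertex, and no
  later edge can touch it.\<close>

lemma path_via_distinct: "path_via G xs p \<Longrightarrow> distinct p"
proof (induction p arbitrary: xs)
  case (Cons e p)
  from Cons.prems show ?case
  proof (rule path_via_ConsE)
    fix x xs'
    assume "x \<notin> set xs'" "ends G e = {x, hd xs'}" "path_via G xs' p"
    then show ?thesis using Cons.IH path_via_ends[of G xs' p e] by auto
  qed
qed simp

lemma path_distinct: "path G u p w \<Longrightarrow> distinct p"
  by (auto simp: path_iff_via path_via_distinct)

lemma path_rev: "path G u p w \<Longrightarrow> path G w (rev p) u"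
  unfolding path_iff_via by (elim exE conjE, rule exI, rule conjI, erule path_via_rev)
    (simp add: hd_rev last_rev)

lemma path_Nil [simp]: "path G u [] w \<longleftrightarrow> u = w \<and> u \<in> verts G"
  by (auto simp: path_iff_via)

lemma path_edges_update:
  "T \<subseteq> edges G \<Longrightarrow> path (G\<lparr>edges := T\<rparr>) u p w \<longleftrightarrow> path G u p w \<and> set p \<subseteq> T"
  unfolding path_def by auto

section \<open>Reachability along a set of edges\<close>

definition adj :: "('v, 'e) rgraph \<Rightarrow> 'e set \<Rightarrow> ('v \<times> 'v) set" where
  "adj G D = {(x, y). \<exists>e\<in>D. ends G e = {x, y}}"

lemma adj_edges_update [simp]: "adj (G\<lparr>edges := T\<rparr>) D = adj G D"
  by (simp add: adj_def)

lemma adj_mono: "D \<subseteq> D' \<Longrightarrow> adj G D \<subseteq> adj G D'"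
  by (auto simp: adj_def)

lemma sym_adj: "sym (adj G D)"
  by (auto simp: sym_def adj_def insert_commute)

lemma reach_sym: "(x, y) \<in> (adj G D)\<^sup>* \<Longrightarrow> (y, x) \<in> (adj G D)\<^sup>*"
  by (rule symD[OF sym_rtrancl[OF sym_adj]])

lemma reach_mono: "(x, y) \<in> (adj G D)\<^sup>* \<Longrightarrow> D \<subseteq> D' \<Longrightarrow> (x, y) \<in> (adj G D')\<^sup>*"
  by (rule subsetD[OF rtrancl_mono[OF adj_mono]])

text \<open>An edge may be sent to a walk of any length, in particular to a single vertex. This
  freedom lets one lemma serve both the embeddings into the wedge and the retractions that collapse
  whole pieces.\<close>

lemma reach_hom:
  assumes "(x, y) \<in> (adj G D)\<^sup>*"
    and "\<And>e x y. e \<in> D \<Longrightarrow> ends G e = {x, y} \<Longrightarrow> (h x, h y) \<in> (adj G' D')\<^sup>*"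
  shows "(h x, h y) \<in> (adj G' D')\<^sup>*"
  using assms(1)
proof induction
  case (step y z)
  then have "(h y, h z) \<in> (adj G' D')\<^sup>*" using assms(2) by (auto simp: adj_def[of G])
  with step.IH show ?case by (rule rtrancl_trans)
qed simp

lemma path_via_reach: "path_via G xs p \<Longrightarrow> (hd xs, last xs) \<in> (adj G (set p))\<^sup>*"
proof (induction p arbitrary: xs)
  case Nil
  then show ?case by auto
next
  case (Cons e p)
  from Cons.prems show ?case
  proof (rule path_via_ConsE)
    fix x xs'
    assume *: "xs = x # xs'" "ends G e = {x, hd xs'}" "path_via G xs' p" "xs' \<noteq> []"
    from Cons.IH[OF *(3)] have "(hd xs', last xs') \<in> (adj G (set (e # p)))\<^sup>*"
      by (rule reach_mono) auto
    moreover have "(x, hd xs') \<in> adj G (set (e # p))"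
      using * by (auto simp: adj_def)
    ultimately show ?thesis using * by (simp add: converse_rtrancl_into_rtrancl)
  qed
qed

lemma path_reach: "path G u p w \<Longrightarrow> (u, w) \<in> (adj G (set p))\<^sup>*"
  by (auto simp: path_iff_via path_via_reach)

lemma rooted_graph_ends:
  "rooted_graph G \<Longrightarrow> e \<in> edges G \<Longrightarrow> ends G e \<subseteq> verts G"
  unfolding rooted_graph_def by fastforce

text \<open>The path grows edge by edge. If the next vertex already lies on it, the path is cut off
  at that vertex instead of being extended, so the vertices stay distinct and no edge outside
  \<open>D\<close> enters.\<close>

lemma reach_path:
  assumes "rooted_graph G" "D \<subseteq> edges G" "u \<in> verts G" "(u, w) \<in> (adj G D)\<^sup>*"
  shows "\<exists>p. path G u p w \<and> set p \<subseteq> D"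
  using assms(4)
proof induction
  case base
  then show ?case using assms by (intro exI[of _ "[]"]) auto
next
  case (step y z)
  from step.IH obtain p xs where p: "path_via G xs p" "hd xs = u" "last xs = y" "set p \<subseteq> D"
    by (auto simp: path_iff_via)
  from step.hyps obtain e where e: "e \<in> D" "ends G e = {y, z}"
    by (auto simp: adj_def)
  have yz: "y \<in> verts G" "z \<in> verts G"
    using rooted_graph_ends[OF assms(1), of e] e assms(2) by auto
  note len = path_viaD(1)[OF p(1)]
  show ?case
  proof (cases "z \<in> set xs")
    case True
    then obtain k where k: "k < length xs" "xs ! k = z" by (auto simp: in_set_conv_nth)
    have "path_via G (take (Suc k) xs) (take k p)"
      using path_via_take[OF p(1)] k len by simp
    moreover have "hd (take (Suc k) xs) = u" using p(2) by (simp add: hd_take)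
    moreover have "last (take (Suc k) xs) = z" using k by (simp add: take_Suc_conv_app_nth)
    moreover have "set (take k p) \<subseteq> D" using p(4) set_take_subset by fast
    ultimately show ?thesis unfolding path_iff_via by blast
  next
    case False
    then have "y \<noteq> z" using p path_viaD(2) last_in_set by metis
    then have "path_via G [y, z] [e]"
      using e yz assms(2) by (auto simp: path_via_Cons)
    from path_via_append[OF p(1) this] have "path_via G (xs @ [z]) (p @ [e])"
      using p False by auto
    moreover have "hd (xs @ [z]) = u" using p path_viaD(2) by fastforce
    ultimately show ?thesis using p(4) e(1) unfolding path_iff_via
      by (intro exI[of _ "p @ [e]"]) auto
  qed
qed

text \<open>Every edge is a bridge. Loops are ruled out as well, because \<open>x = y\<close> makes
  the pair reachable by the empty walk.\<close>

definition forest :: "('v, 'e) rgraph \<Rightarrow> 'e set \<Rightarrow> bool" where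
  "forest G D \<longleftrightarrow> (\<forall>e\<in>D. \<forall>x y. ends G e = {x, y} \<longrightarrow> (x, y) \<notin> (adj G (D - {e}))\<^sup>*)"

lemma forest_edges_update [simp]: "forest (G\<lparr>edges := T\<rparr>) D = forest G D"
  by (simp add: forest_def)

lemma forest_mono: "forest G D' \<Longrightarrow> D \<subseteq> D' \<Longrightarrow> forest G D"
  unfolding forest_def by (meson Diff_mono equalityD1 reach_mono subsetD)

lemma cycle_in_path_via:
  assumes "cycle_in G xs fs"
  shows "path_via G xs (butlast fs)" "ends G (last fs) = {last xs, hd xs}"
proof -
  from assms have *: "xs \<noteq> []" "length fs = length xs" "distinct xs"
     "set xs \<subseteq> verts G" "set fs \<subseteq> edges G"
     "\<And>i. i<length xs \<Longrightarrow> ends G (fs ! i) = {xs ! i, xs ! (Suc i mod length xs)}"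
    by (auto simp: cycle_in_def)
  then have "fs \<noteq> []" by auto
  then show "ends G (last fs) = {last xs, hd xs}"
    using * *(6)[of "length xs - 1"] by (auto simp: last_conv_nth hd_conv_nth)
  show "path_via G xs (butlast fs)"
    using * unfolding path_via_def by (auto simp: nth_butlast dest: in_set_butlastD)
qed

lemma path_via_cycle_in:
  assumes "path_via G xs p" "e \<in> edges G" "e \<notin> set p" "ends G e = {last xs, hd xs}"
  shows "cycle_in G xs (p @ [e])"
proof -
  have "ends G ((p @ [e]) ! i) = {xs ! i, xs ! (Suc i mod length xs)}" if "i < length xs" for i
  proof (cases "i < length p")
    case True
    then show ?thesis using assms(1) by (auto simp: path_via_def nth_append)
  next
    case False
    then have "i = length p" "length xs = Suc (length p)" "xs \<noteq> []"
      using that assms(1) by (auto simp: path_via_def)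
    then show ?thesis using assms(4) by (auto simp: nth_append last_conv_nth hd_conv_nth)
  qed
  then show ?thesis
    using assms path_via_distinct[OF assms(1)] by (auto simp: cycle_in_def path_via_def)
qed

text \<open>A cycle without its last edge is a path between the ends of that edge. Conversely, a
  walk that joins the ends of \<open>e\<close> and avoids \<open>e\<close> shortens to a path, which
  \<open>e\<close> closes to a cycle.\<close>

lemma forest_iff_no_cycle:
  assumes "rooted_graph G"
  shows "forest G (edges G) \<longleftrightarrow> \<not> (\<exists>xs fs. cycle_in G xs fs)"
proof
  assume f: "forest G (edges G)"
  show "\<not> (\<exists>xs fs. cycle_in G xs fs)"
  proof clarify
    fix xs fs assume c: "cycle_in G xs fs"
    then have ne: "fs \<noteq> []" "distinct fs" "set fs \<subseteq> edges G" by (auto simp: cycle_in_def)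
    then have d: "last fs \<notin> set (butlast fs)" "last fs \<in> edges G"
      by (metis append_butlast_last_id distinct_butlast not_distinct_conv_prefix) (use ne in auto)
    have "(hd xs, last xs) \<in> (adj G (edges G - {last fs}))\<^sup>*"
      using path_via_reach[OF cycle_in_path_via(1)[OF c]] ne d
      by (elim reach_mono) (auto dest: in_set_butlastD)
    then show False using f d cycle_in_path_via(2)[OF c]
      unfolding forest_def by (metis insert_commute)
  qed
next
  assume n: "\<not> (\<exists>xs fs. cycle_in G xs fs)"
  show "forest G (edges G)" unfolding forest_def
  proof (intro ballI allI impI notI)
    fix e x y assume e: "e \<in> edges G" "ends G e = {x, y}"
      and r: "(x, y) \<in> (adj G (edges G - {e}))\<^sup>*"
    have "x \<in> verts G" using rooted_graph_ends[OF assms e(1)] e by auto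
    from reach_path[OF assms _ this r] obtain p where "path G x p y" "set p \<subseteq> edges G - {e}"
      by auto
    then obtain xs where "path_via G xs p" "hd xs = x" "last xs = y" "e \<notin> set p"
      by (auto simp: path_iff_via)
    with path_via_cycle_in[of G xs p e] e n show False by (auto simp: insert_commute)
  qed
qed

lemma rooted_graph_edges_update:
  "rooted_graph G \<Longrightarrow> T \<subseteq> edges G \<Longrightarrow> rooted_graph (G\<lparr>edges := T\<rparr>)"
  unfolding rooted_graph_def by (auto intro: finite_subset)

text \<open>Reachability is symmetric, so joining every vertex to the root already joins every
  pair.\<close>

lemma tree_iff:
  assumes "rooted_graph G"
  shows "tree G \<longleftrightarrow> (\<forall>w\<in>verts G. (groot G, w) \<in> (adj G (edges G))\<^sup>*) \<and> forest G (edges G)"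
proof -
  have "connected_graph G \<longleftrightarrow> (\<forall>w\<in>verts G. (groot G, w) \<in> (adj G (edges G))\<^sup>*)" (is "_ \<longleftrightarrow> ?R")
  proof
    assume c: "connected_graph G"
    show ?R
    proof
      fix w assume "w \<in> verts G"
      then obtain p where "path G (groot G) p w"
        using c assms unfolding connected_graph_def rooted_graph_def by blast
      moreover from this have "set p \<subseteq> edges G" by (auto simp: path_def)
      ultimately show "(groot G, w) \<in> (adj G (edges G))\<^sup>*" using path_reach reach_mono by metis
    qed
  next
    assume r: ?R
    show "connected_graph G" unfolding connected_graph_def
    proof (intro ballI)
      fix u w assume uw: "u \<in> verts G" "w \<in> verts G"
      then have "(u, w) \<in> (adj G (edges G))\<^sup>*"
        using r reach_sym rtrancl_trans by metis
      then show "\<exists>p. path G u p w" using reach_path[OF assms _ uw(1)] by blast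
    qed
  qed
  then show ?thesis using forest_iff_no_cycle[OF assms] by (simp add: tree_def)
qed

lemma spanning_tree_iff:
  assumes "rooted_graph G"
  shows "spanning_tree G T \<longleftrightarrow>
    T \<subseteq> edges G \<and> (\<forall>w\<in>verts G. (groot G, w) \<in> (adj G T)\<^sup>*) \<and> forest G T"
  using tree_iff[OF rooted_graph_edges_update[OF assms], of T] by (auto simp: spanning_tree_def)

text \<open>If the first edge of \<open>p\<close> were missing from \<open>q\<close>, the rest of \<open>p\<close> followed by the reverse of
  \<open>q\<close> would join its endpoints; otherwise it can only be the first edge of \<open>q\<close>.\<close>

lemma path_unique:
  assumes "forest G D"
  shows "path G u p w \<Longrightarrow> path G u q w \<Longrightarrow> set p \<subseteq> D \<Longrightarrow> set q \<subseteq> D \<Longrightarrow> p = q"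
proof (induction p arbitrary: u q)
  case Nil
  then obtain xs where xs: "path_via G xs q" "hd xs = last xs" by (auto simp: path_iff_via)
  then show ?case
    by (metis path_via_ConsE hd_Cons_tl last_ConsR last_in_set list.sel(1))
next
  case (Cons e p)
  from Cons.prems(1) obtain x xs where xs: "x \<notin> set xs" "ends G e = {x, hd xs}"
    "path_via G xs p" "xs \<noteq> []" "last xs = w" "x = u"
    unfolding path_iff_via by (metis path_via_ConsE list.sel(1) last_ConsR)
  have "e \<notin> set p" using path_distinct[OF Cons.prems(1)] by simp
  show ?case
  proof (cases "e \<in> set q")
    case False
    have "(hd xs, w) \<in> (adj G (D - {e}))\<^sup>*"
      using path_via_reach[OF xs(3)] xs(5) Cons.prems(3) \<open>e \<notin> set p\<close>
      by (auto elim: reach_mono)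
    moreover have "(w, u) \<in> (adj G (D - {e}))\<^sup>*"
      using path_reach[OF Cons.prems(2)] Cons.prems(4) False
      by (auto intro!: reach_sym[of u] elim: reach_mono)
    ultimately have "(hd xs, u) \<in> (adj G (D - {e}))\<^sup>*" by (rule rtrancl_trans)
    then have "(u, hd xs) \<in> (adj G (D - {e}))\<^sup>*" by (rule reach_sym)
    moreover have "e \<in> D" using Cons.prems(3) by simp
    ultimately have False using assms xs(2,6) unfolding forest_def by auto
    then show ?thesis ..
  next
    case True
    then obtain f q' where q: "q = f # q'" by (cases q) auto
    with Cons.prems(2) obtain ys where ys: "u \<notin> set ys" "ends G f = {u, hd ys}"
      "path_via G ys q'" "ys \<noteq> []" "last ys = w"
      unfolding path_iff_via by (metis path_via_ConsE list.sel(1) last_ConsR)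
    have "e \<notin> set q'" using path_via_ends[OF ys(3)] xs(2,6) ys(1) by auto
    with True q have "f = e" by simp
    then have "hd ys = hd xs" using xs(1,2,4,6) ys(1,2,4)
      by (metis doubleton_eq_iff)
    then have "p = q'"
      using Cons.IH[of "hd xs" q'] xs ys Cons.prems q by (auto simp: path_iff_via)
    with \<open>f = e\<close> q show ?thesis by simp
  qed
qed

text \<open>Tree paths are evaluated through this rule: once some path inside the tree is exhibited,
  uniqueness resolves the \<open>THE\<close>.\<close>

lemma tree_path_eqI:
  assumes "rooted_graph G" "spanning_tree G T" "path G (groot G) p w" "set p \<subseteq> T"
  shows "tree_path G T w = p"
proof -
  from assms(1,2) have T: "T \<subseteq> edges G" "forest G T" by (auto simp: spanning_tree_iff)
  show ?thesis unfolding tree_path_def path_edges_update[OF T(1)]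
    by (rule the_equality) (use assms path_unique[OF T(2)] in auto)
qed

lemma tree_path_works:
  assumes "rooted_graph G" "spanning_tree G T" "w \<in> verts G"
  shows "path G (groot G) (tree_path G T w) w" "set (tree_path G T w) \<subseteq> T"
proof -
  from assms have "T \<subseteq> edges G" "(groot G, w) \<in> (adj G T)\<^sup>*" "groot G \<in> verts G"
    by (auto simp: spanning_tree_iff rooted_graph_def)
  then obtain p where "path G (groot G) p w" "set p \<subseteq> T" using reach_path[OF assms(1)] by blast
  with tree_path_eqI[OF assms(1,2) this]
  show "path G (groot G) (tree_path G T w) w" "set (tree_path G T w) \<subseteq> T" by auto
qed

section \<open>Spanning trees of wedges and their costs\<close>

lemma sum_Plus:
  fixes f :: "'a + 'b \<Rightarrow> 'c::comm_monoid_add"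
  assumes "finite A" "finite B"
  shows "sum f (A <+> B) = (\<Sum>x\<in>A. f (Inl x)) + (\<Sum>x\<in>B. f (Inr x))"
  unfolding Plus_def using assms by (subst sum.union_disjoint) (auto simp: sum.reindex)

definition tree_dist :: "('v, 'e) rgraph \<Rightarrow> 'e set \<Rightarrow> 'v \<Rightarrow> real" where
  "tree_dist G T w = (\<Sum>e\<in>set (tree_path G T w). \<gamma> G e)"

lemma cost_tree_dist: "cost G T = sum (\<tau> G) T + sum (tree_dist G T) (verts G)"
  by (simp add: cost_def tree_dist_def)

lemma tree_path_root:
  assumes "rooted_graph G" "spanning_tree G T"
  shows "tree_path G T (groot G) = []"
  using assms by (intro tree_path_eqI) (auto simp: rooted_graph_def)

locale rooted_wedge =
  fixes n :: nat and G :: "('v, 'e) rgraph" and v :: "nat \<Rightarrow> 'v"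
    and H :: "nat \<Rightarrow> ('w, 'f) rgraph"
  assumes rooted_G: "rooted_graph G"
    and rooted_H: "i \<in> {1..n} \<Longrightarrow> rooted_graph (H i)"
    and attach: "i \<in> {1..n} \<Longrightarrow> v i \<in> verts G"
begin

abbreviation W where "W \<equiv> wedge n G v H"
abbreviation emb where "emb \<equiv> wedge_emb v H"

lemma W_simps [simp]:
  "ends W (Inl e) = Inl ` ends G e" "ends W (Inr (i, f)) = emb i ` ends (H i) f"
  "groot W = Inl (groot G)" "\<gamma> W (Inl e) = \<gamma> G e" "\<gamma> W (Inr (i, f)) = \<gamma> (H i) f"
  "\<tau> W (Inl e) = \<tau> G e" "\<tau> W (Inr (i, f)) = \<tau> (H i) f"
  "edges W = wedge_edges n (edges G) (\<lambda>i. edges (H i))"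
  by (simp_all add: wedge_def)

lemma mem_wedge_edges [simp]:
  "Inl e \<in> wedge_edges n T S \<longleftrightarrow> e \<in> T"
  "Inr (i, f) \<in> wedge_edges n T S \<longleftrightarrow> i \<in> {1..n} \<and> f \<in> S i"
  by (auto simp: wedge_edges_def)

lemma wedge_edges_Plus: "wedge_edges n T S = T <+> Sigma {1..n} S"
  by (auto simp: wedge_edges_def Plus_def)

lemma emb_root [simp]: "emb i (groot (H i)) = Inl (v i)"
  by (simp add: wedge_emb_def)

lemma inj_emb: "inj (emb i)"
  by (auto simp: inj_def wedge_emb_def split: if_splits)

text \<open>The union in \<open>wedge\<close> is not disjoint, since each embedded root is a vertex
  of \<open>G\<close>. Without the roots it becomes a disjoint sum, over which the cost can be
  split.\<close>

lemma verts_W: "verts W = verts G <+> Sigma {1..n} (\<lambda>i. verts (H i) - {groot (H i)})"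
proof (rule set_eqI)
  fix x
  show "x \<in> verts W \<longleftrightarrow> x \<in> verts G <+> Sigma {1..n} (\<lambda>i. verts (H i) - {groot (H i)})"
  proof (cases x)
    case (Inl a)
    then show ?thesis using attach by (auto simp: wedge_def wedge_emb_def split: if_splits)
  next
    case (Inr b)
    then show ?thesis by (cases b) (auto simp: wedge_def wedge_emb_def image_iff)
  qed
qed

lemma emb_in_verts: "i \<in> {1..n} \<Longrightarrow> x \<in> verts (H i) \<Longrightarrow> emb i x \<in> verts W"
  by (auto simp: wedge_def)

lemma rooted_W: "rooted_graph W"
proof -
  have fin: "finite (verts G)" "finite (edges G)"
    "\<And>i. i \<in> {1..n} \<Longrightarrow> finite (verts (H i)) \<and> finite (edges (H i))"
    using rooted_G rooted_H by (auto simp: rooted_graph_def)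
  have "\<exists>x\<in>verts W. \<exists>y\<in>verts W. ends W e = {x, y}" if e: "e \<in> edges W" for e
  proof (cases e)
    case (Inl e')
    then obtain x y where "x \<in> verts G" "y \<in> verts G" "ends G e' = {x, y}"
      using e rooted_G by (auto simp: rooted_graph_def)
    then show ?thesis using Inl by (intro bexI[of _ "Inl x"] bexI[of _ "Inl y"]) (auto simp: verts_W)
  next
    case (Inr a)
    then obtain i f where a: "e = Inr (i, f)" by (cases a) auto
    then have i: "i \<in> {1..n}" "f \<in> edges (H i)" using e by auto
    then obtain x y where "x \<in> verts (H i)" "y \<in> verts (H i)" "ends (H i) f = {x, y}"
      using rooted_H[OF i(1)] by (auto simp: rooted_graph_def)
    then show ?thesis using a i
      by (intro bexI[of _ "emb i x"] bexI[of _ "emb i y"]) (auto intro: emb_in_verts)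
  qed
  moreover have "finite (verts W)" "finite (edges W)"
    using fin by (auto simp: verts_W wedge_edges_Plus intro!: finite_Plus finite_SigmaI)
  moreover have "groot W \<in> verts W"
    using rooted_G by (auto simp: verts_W rooted_graph_def)
  ultimately show ?thesis unfolding rooted_graph_def by blast
qed

lemma reach_Inl:
  assumes "(x, y) \<in> (adj G D)\<^sup>*" "Inl ` D \<subseteq> D'"
  shows "(Inl x, Inl y) \<in> (adj W D')\<^sup>*"
proof (rule reach_hom[OF assms(1)])
  fix e x y assume "e \<in> D" "ends G e = {x, y}"
  then have "(Inl x, Inl y) \<in> adj W D'"
    using assms(2) by (auto simp: adj_def intro!: bexI[of _ "Inl e"])
  then show "(Inl x, Inl y) \<in> (adj W D')\<^sup>*" ..
qed

lemma reach_emb: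
  assumes "(x, y) \<in> (adj (H i) D)\<^sup>*" "(\<lambda>f. Inr (i, f)) ` D \<subseteq> D'"
  shows "(emb i x, emb i y) \<in> (adj W D')\<^sup>*"
proof (rule reach_hom[OF assms(1)])
  fix f x y assume "f \<in> D" "ends (H i) f = {x, y}"
  then have "(emb i x, emb i y) \<in> adj W D'"
    using assms(2) by (auto simp: adj_def intro!: bexI[of _ "Inr (i, f)"])
  then show "(emb i x, emb i y) \<in> (adj W D')\<^sup>*" ..
qed

section \<open>Retractions of the wedge onto its pieces\<close>

definition retract_G :: "'v + nat \<times> 'w \<Rightarrow> 'v" where
  "retract_G = case_sum id (\<lambda>(i, x). v i)"

text \<open>Everything outside copy \<open>i\<close> goes to the root of \<open>H i\<close>. This is
  consistent on the shared vertex: it is stored as \<open>Inl (v i)\<close>, and it is the image of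
  that root under \<open>wedge_emb\<close>.\<close>

definition retract_H :: "nat \<Rightarrow> 'v + nat \<times> 'w \<Rightarrow> 'w" where
  "retract_H i = case_sum (\<lambda>x. groot (H i)) (\<lambda>(j, x). if j = i then x else groot (H i))"

lemma retract_G_simps [simp]: "retract_G (Inl x) = x" "retract_G (emb i y) = v i"
  by (auto simp: retract_G_def wedge_emb_def)

lemma retract_H_simps [simp]: "retract_H i (Inl x) = groot (H i)"
  "retract_H i (emb j y) = (if j = i then y else groot (H i))"
  by (auto simp: retract_H_def wedge_emb_def)

lemma retract_G_ends:
  assumes "ends W e = {x, y}"
  shows "case e of Inl e' \<Rightarrow> ends G e' = {retract_G x, retract_G y} | Inr _ \<Rightarrow> retract_G x = retract_G y"
proof (cases e)
  case (Inl e')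
  have "retract_G ` Inl ` ends G e' = {retract_G x, retract_G y}" using assms Inl by simp
  then show ?thesis using Inl by (simp add: image_image)
next
  case (Inr a)
  then obtain i f where "e = Inr (i, f)" by (cases a) auto
  then have "x \<in> range (emb i)" "y \<in> range (emb i)" using assms by auto
  then show ?thesis using Inr by auto
qed

lemma retract_H_ends:
  assumes "ends W e = {x, y}"
  shows "if \<exists>f. e = Inr (i, f) then ends (H i) (snd (projr e)) = {retract_H i x, retract_H i y}
    else retract_H i x = retract_H i y"
proof (cases e)
  case (Inl e')
  then have "x \<in> range Inl" "y \<in> range Inl" using assms by auto
  then show ?thesis using Inl by auto
next
  case (Inr a)
  then obtain j f where e: "e = Inr (j, f)" by (cases a) auto
  show ?thesis
  proof (cases "j = i")
    case True
    have "retract_H i ` emb i ` ends (H i) f = {retract_H i x, retract_H i y}"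
      using assms e True by simp
    then show ?thesis using e True by (simp add: image_image)
  next
    case False
    have "x \<in> range (emb j)" "y \<in> range (emb j)" using assms e by auto
    then show ?thesis using e False by auto
  qed
qed

lemma reach_retract_G:
  assumes "(x, y) \<in> (adj W D)\<^sup>*" "Inl -` D \<subseteq> D'"
  shows "(retract_G x, retract_G y) \<in> (adj G D')\<^sup>*"
proof (rule reach_hom[OF assms(1)])
  fix e x y assume e: "e \<in> D" "ends W e = {x, y}"
  show "(retract_G x, retract_G y) \<in> (adj G D')\<^sup>*"
    using retract_G_ends[OF e(2)] e(1) assms(2)
    by (cases e) (auto simp: adj_def intro!: r_into_rtrancl)
qed

lemma reach_retract_H:
  assumes "(x, y) \<in> (adj W D)\<^sup>*" "{f. Inr (i, f) \<in> D} \<subseteq> D'"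
  shows "(retract_H i x, retract_H i y) \<in> (adj (H i) D')\<^sup>*"
proof (rule reach_hom[OF assms(1)])
  fix e x y assume e: "e \<in> D" "ends W e = {x, y}"
  show "(retract_H i x, retract_H i y) \<in> (adj (H i) D')\<^sup>*"
    using retract_H_ends[OF e(2), of i] e(1) assms(2)
    by (auto simp: adj_def intro!: r_into_rtrancl split: if_splits)
qed

text \<open>A detour around an edge inside one piece embeds into the wedge. Conversely, a detour in
  the wedge retracts onto the piece containing the edge: the edges of all other pieces collapse, so
  what remains avoids the edge within its own piece.\<close>

lemma forest_wedge:
  "forest W (wedge_edges n T S) \<longleftrightarrow> forest G T \<and> (\<forall>i\<in>{1..n}. forest (H i) (S i))"
proof (intro iffI conjI ballI)
  assume F: "forest W (wedge_edges n T S)"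
  show "forest G T" unfolding forest_def
  proof (intro ballI allI impI notI)
    fix e x y assume e: "e \<in> T" "ends G e = {x, y}" "(x, y) \<in> (adj G (T - {e}))\<^sup>*"
    have "(Inl x, Inl y) \<in> (adj W (wedge_edges n T S - {Inl e}))\<^sup>*"
      by (rule reach_Inl[OF e(3)]) auto
    moreover have "Inl e \<in> wedge_edges n T S" "ends W (Inl e) = {Inl x, Inl y}" using e by auto
    ultimately show False using F unfolding forest_def by blast
  qed
  fix i assume i: "i \<in> {1..n}"
  show "forest (H i) (S i)" unfolding forest_def
  proof (intro ballI allI impI notI)
    fix f x y assume f: "f \<in> S i" "ends (H i) f = {x, y}" "(x, y) \<in> (adj (H i) (S i - {f}))\<^sup>*"
    have "(emb i x, emb i y) \<in> (adj W (wedge_edges n T S - {Inr (i, f)}))\<^sup>*"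
      by (rule reach_emb[OF f(3)]) (use i in auto)
    moreover have "Inr (i, f) \<in> wedge_edges n T S" "ends W (Inr (i, f)) = {emb i x, emb i y}"
      using f i by auto
    ultimately show False using F unfolding forest_def by blast
  qed
next
  assume F: "forest G T \<and> (\<forall>i\<in>{1..n}. forest (H i) (S i))"
  show "forest W (wedge_edges n T S)" unfolding forest_def
  proof (intro ballI allI impI notI)
    fix e x y assume e: "e \<in> wedge_edges n T S" "ends W e = {x, y}"
      and r: "(x, y) \<in> (adj W (wedge_edges n T S - {e}))\<^sup>*"
    show False
    proof (cases e)
      case (Inl e')
      have "(retract_G x, retract_G y) \<in> (adj G (T - {e'}))\<^sup>*"
        by (rule reach_retract_G[OF r]) (use Inl in auto)
      moreover have "e' \<in> T" "ends G e' = {retract_G x, retract_G y}"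
        using Inl e retract_G_ends[OF e(2)] by auto
      ultimately show False using F unfolding forest_def by blast
    next
      case (Inr a)
      then obtain i f where a: "e = Inr (i, f)" by (cases a) auto
      have "(retract_H i x, retract_H i y) \<in> (adj (H i) (S i - {f}))\<^sup>*"
        by (rule reach_retract_H[OF r]) (use a in auto)
      moreover have "i \<in> {1..n}" "f \<in> S i" "ends (H i) f = {retract_H i x, retract_H i y}"
        using a e retract_H_ends[OF e(2), of i] by auto
      ultimately show False using F unfolding forest_def by blast
    qed
  qed
qed

lemma spanning_tree_wedge:
  "spanning_tree W (wedge_edges n T S) \<longleftrightarrow>
     spanning_tree G T \<and> (\<forall>i\<in>{1..n}. spanning_tree (H i) (S i))"
proof -
  let ?T = "wedge_edges n T S"
  have sub: "?T \<subseteq> edges W \<longleftrightarrow> T \<subseteq> edges G \<and> (\<forall>i\<in>{1..n}. S i \<subseteq> edges (H i))"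
    by (fastforce simp: wedge_edges_def)
  have "(\<forall>w\<in>verts W. (groot W, w) \<in> (adj W ?T)\<^sup>*) \<longleftrightarrow>
     (\<forall>w\<in>verts G. (groot G, w) \<in> (adj G T)\<^sup>*) \<and>
     (\<forall>i\<in>{1..n}. \<forall>w\<in>verts (H i). (groot (H i), w) \<in> (adj (H i) (S i))\<^sup>*)"
    (is "?l \<longleftrightarrow> ?r1 \<and> ?r2")
  proof (intro iffI conjI ballI)
    fix w assume l: ?l and w: "w \<in> verts G"
    then have "(groot W, Inl w) \<in> (adj W ?T)\<^sup>*" by (auto simp: verts_W)
    then have "(retract_G (groot W), retract_G (Inl w)) \<in> (adj G T)\<^sup>*"
      by (rule reach_retract_G) auto
    then show "(groot G, w) \<in> (adj G T)\<^sup>*" by simp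
  next
    fix i w assume l: ?l and i: "i \<in> {1..n}" and w: "w \<in> verts (H i)"
    then have "(groot W, emb i w) \<in> (adj W ?T)\<^sup>*" using emb_in_verts by blast
    \<comment> \<open>The root of the wedge lies in \<open>G\<close>, so it retracts to the root of
      \<open>H i\<close>.\<close>
    then have "(retract_H i (groot W), retract_H i (emb i w)) \<in> (adj (H i) (S i))\<^sup>*"
      by (rule reach_retract_H) auto
    then show "(groot (H i), w) \<in> (adj (H i) (S i))\<^sup>*" by simp
  next
    fix w assume r: "?r1 \<and> ?r2" and w: "w \<in> verts W"
    have 1: "(groot W, Inl w) \<in> (adj W ?T)\<^sup>*" if "w \<in> verts G" for w
    proof -
      from r that have "(groot G, w) \<in> (adj G T)\<^sup>*" by blast
      then have "(Inl (groot G), Inl w) \<in> (adj W ?T)\<^sup>*" by (rule reach_Inl) auto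
      then show ?thesis by simp
    qed
    show "(groot W, w) \<in> (adj W ?T)\<^sup>*"
    proof (cases w)
      case (Inl a)
      then show ?thesis using 1 w by (auto simp: verts_W)
    next
      case (Inr a)
      then obtain i x where x: "w = Inr (i, x)" by (cases a) auto
      then have i: "i \<in> {1..n}" "x \<in> verts (H i)" "emb i x = w"
        using w by (auto simp: verts_W wedge_emb_def)
      \<comment> \<open>The walk reaches the attaching vertex inside \<open>G\<close> and continues
        in the copy of \<open>H i\<close>, whose root is that vertex.\<close>
      then have "(groot (H i), x) \<in> (adj (H i) (S i))\<^sup>*" using r by blast
      then have "(emb i (groot (H i)), emb i x) \<in> (adj W ?T)\<^sup>*"
        by (rule reach_emb) (use i in auto)
      then have "(Inl (v i), w) \<in> (adj W ?T)\<^sup>*" using i by simp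
      with 1[OF attach[OF i(1)]] show ?thesis by (rule rtrancl_trans)
    qed
  qed
  moreover have "spanning_tree (H i) (S i) \<longleftrightarrow> S i \<subseteq> edges (H i) \<and>
     (\<forall>w\<in>verts (H i). (groot (H i), w) \<in> (adj (H i) (S i))\<^sup>*) \<and> forest (H i) (S i)"
    if "i \<in> {1..n}" for i using spanning_tree_iff[OF rooted_H[OF that]] .
  ultimately show ?thesis
    unfolding spanning_tree_iff[OF rooted_W] spanning_tree_iff[OF rooted_G] sub forest_wedge
    by auto
qed

text \<open>\<open>T\<close> lies in \<open>edges W\<close>, so its right summands carry only
  indices from \<open>{1..n}\<close>. Applied to a spanning tree of the wedge, this shows together
  with \<open>spanning_tree_wedge\<close> that its parts are spanning trees of the pieces.\<close>

lemma wedge_edges_decomp: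
  assumes "T \<subseteq> edges W"
  shows "T = wedge_edges n (Inl -` T) (\<lambda>i. {f. Inr (i, f) \<in> T})"
proof (rule set_eqI)
  fix e show "e \<in> T \<longleftrightarrow> e \<in> wedge_edges n (Inl -` T) (\<lambda>i. {f. Inr (i, f) \<in> T})"
    using assms by (cases e) (auto dest!: subsetD simp: wedge_edges_Plus)
qed

section \<open>Distances and cost in a tree of the wedge\<close>

lemma path_via_map_Inl:
  "path_via G xs p \<Longrightarrow> path_via W (map Inl xs) (map Inl p)"
  by (auto simp: path_via_def distinct_map verts_W)

lemma path_via_map_emb:
  "i \<in> {1..n} \<Longrightarrow> path_via (H i) xs p \<Longrightarrow> path_via W (map (emb i) xs) (map (\<lambda>f. Inr (i, f)) p)"
  using inj_on_subset[OF inj_emb subset_UNIV] emb_in_verts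
  by (auto simp: path_via_def distinct_map)

lemma path_emb:
  assumes i: "i \<in> {1..n}" and p: "path G (groot G) p (v i)" and q: "path (H i) (groot (H i)) q w"
  shows "path W (groot W) (map Inl p @ map (\<lambda>f. Inr (i, f)) q) (emb i w)"
proof -
  from p obtain xs where xs: "path_via G xs p" "hd xs = groot G" "last xs = v i"
    by (auto simp: path_iff_via)
  from q obtain ys where ys: "path_via (H i) ys q" "hd ys = groot (H i)" "last ys = w"
    by (auto simp: path_iff_via)
  obtain zs where zs: "ys = groot (H i) # zs" using ys(2) path_viaD(2)[OF ys(1)] by (cases ys) auto
  have ne: "xs \<noteq> []" using path_viaD(2)[OF xs(1)] .
  \<comment> \<open>Away from its root, \<open>H i\<close> is embedded into the right summand. The
    glued path therefore visits no vertex twice.\<close>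
  have "groot (H i) \<notin> set zs" using path_viaD(3)[OF ys(1)] zs by simp
  then have "set (map Inl xs) \<inter> set (map (emb i) zs) = {}" by (auto simp: wedge_emb_def)
  then have "path_via W (map Inl xs @ map (emb i) zs) (map Inl p @ map (\<lambda>f. Inr (i, f)) q)"
    using path_via_map_Inl[OF xs(1)] path_via_map_emb[OF i ys(1)] xs ne zs
    by (intro path_via_append[where y = "Inl (v i)"]) (auto simp: last_map)
  moreover have "hd (map Inl xs @ map (emb i) zs) = groot W" using ne xs by (simp add: hd_map)
  moreover have "last (map Inl xs @ map (emb i) zs) = emb i w"
    using ne xs ys zs by (cases "zs = []") (auto simp: last_map)
  ultimately show ?thesis unfolding path_iff_via by blast
qed

context
  fixes T :: "'e set" and S :: "nat \<Rightarrow> 'f set"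
  assumes T: "spanning_tree G T" and S: "\<And>i. i \<in> {1..n} \<Longrightarrow> spanning_tree (H i) (S i)"
begin

lemma spanning_tree_W: "spanning_tree W (wedge_edges n T S)"
  using T S by (simp add: spanning_tree_wedge)

lemma tree_dist_Inl:
  assumes "w \<in> verts G"
  shows "tree_dist W (wedge_edges n T S) (Inl w) = tree_dist G T w"
proof -
  note p = tree_path_works[OF rooted_G T assms]
  from p(1) obtain xs where xs: "path_via G xs (tree_path G T w)" "hd xs = groot G" "last xs = w"
    by (auto simp: path_iff_via)
  have "path W (groot W) (map Inl (tree_path G T w)) (Inl w)"
    using path_via_map_Inl[OF xs(1)] xs path_viaD(2)[OF xs(1)]
    unfolding path_iff_via by (intro exI[of _ "map Inl xs"]) (auto simp: hd_map last_map)
  with p(2) have "tree_path W (wedge_edges n T S) (Inl w) = map Inl (tree_path G T w)"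
    by (intro tree_path_eqI rooted_W spanning_tree_W) auto
  then show ?thesis by (simp add: tree_dist_def sum.reindex)
qed

lemma tree_dist_Inr:
  assumes "i \<in> {1..n}" "w \<in> verts (H i)" "w \<noteq> groot (H i)"
  shows "tree_dist W (wedge_edges n T S) (Inr (i, w)) =
    tree_dist G T (v i) + tree_dist (H i) (S i) w"
proof -
  note p = tree_path_works[OF rooted_G T attach[OF assms(1)]]
  note q = tree_path_works[OF rooted_H S, OF assms(1,1,2)]
  let ?p = "tree_path G T (v i)" and ?q = "tree_path (H i) (S i) w"
  have "tree_path W (wedge_edges n T S) (emb i w) = map Inl ?p @ map (\<lambda>f. Inr (i, f)) ?q"
    using p(2) q(2) assms(1)
    by (intro tree_path_eqI rooted_W spanning_tree_W path_emb p(1) q(1)) auto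
  moreover have "emb i w = Inr (i, w)" using assms(3) by (simp add: wedge_emb_def)
  ultimately have "tree_dist W (wedge_edges n T S) (Inr (i, w)) =
    sum (\<gamma> W) (set ?p <+> Pair i ` set ?q)"
    by (simp add: tree_dist_def Plus_def image_image)
  also have "\<dots> = tree_dist G T (v i) + tree_dist (H i) (S i) w"
    by (simp add: sum_Plus tree_dist_def sum.reindex inj_on_def)
  finally show ?thesis .
qed

lemma cost_wedge:
  "cost W (wedge_edges n T S) = cost G T + (\<Sum>i=1..n. cost (H i) (S i)) +
     (\<Sum>i=1..n. tree_dist G T (v i) * (real (card (verts (H i))) - 1))"
proof -
  let ?V = "\<lambda>i. verts (H i) - {groot (H i)}"
  have finG: "finite (verts G)" "finite T"
    using rooted_G T by (auto simp: rooted_graph_def spanning_tree_def intro: finite_subset)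
  have finH: "finite (verts (H i))" "finite (S i)" "groot (H i) \<in> verts (H i)" if "i \<in> {1..n}" for i
    using rooted_H[OF that] S[OF that]
    by (auto simp: rooted_graph_def spanning_tree_def intro: finite_subset)
  have "(\<Sum>x\<in>Sigma {1..n} S. \<tau> W (Inr x)) = (\<Sum>i=1..n. sum (\<tau> (H i)) (S i))"
    using finH by (subst sum.Sigma) (auto intro!: sum.cong)
  then have "sum (\<tau> W) (wedge_edges n T S) = sum (\<tau> G) T + (\<Sum>i=1..n. sum (\<tau> (H i)) (S i))"
    unfolding wedge_edges_Plus using finG finH by (subst sum_Plus) auto
  moreover have "sum (tree_dist W (wedge_edges n T S)) (verts W) =
     sum (tree_dist G T) (verts G) +
     (\<Sum>i=1..n. \<Sum>w\<in>?V i. tree_dist G T (v i) + tree_dist (H i) (S i) w)"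
  proof -
    have "sum (tree_dist W (wedge_edges n T S)) (verts W) =
       (\<Sum>w\<in>verts G. tree_dist W (wedge_edges n T S) (Inl w)) +
       (\<Sum>x\<in>Sigma {1..n} ?V. tree_dist W (wedge_edges n T S) (Inr x))"
      unfolding verts_W using finG finH by (intro sum_Plus) auto
    also have "(\<Sum>x\<in>Sigma {1..n} ?V. tree_dist W (wedge_edges n T S) (Inr x)) =
       (\<Sum>i=1..n. \<Sum>w\<in>?V i. tree_dist W (wedge_edges n T S) (Inr (i, w)))"
      using finH by (subst sum.Sigma) (auto simp: split_def)
    also have "\<dots> = (\<Sum>i=1..n. \<Sum>w\<in>?V i. tree_dist G T (v i) + tree_dist (H i) (S i) w)"
      by (intro sum.cong refl tree_dist_Inr) auto
    finally show ?thesis by (simp add: tree_dist_Inl)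
  qed
  moreover have "sum (\<tau> (H i)) (S i) + (\<Sum>w\<in>?V i. tree_dist G T (v i) + tree_dist (H i) (S i) w) =
      cost (H i) (S i) + tree_dist G T (v i) * (real (card (verts (H i))) - 1)"
    if i: "i \<in> {1..n}" for i
  proof -
    \<comment> \<open>The root is at distance 0 from itself, so dropping it leaves the distance sum
      of \<open>H i\<close> unchanged. Dropping it does lower the number of copies of
      \<open>tree_dist G T (v i)\<close> by one; the vertex itself is already counted in
      \<open>G\<close>.\<close>
    have "tree_dist (H i) (S i) (groot (H i)) = 0"
      using tree_path_root[OF rooted_H S, OF i i] by (simp add: tree_dist_def)
    then have "sum (tree_dist (H i) (S i)) (verts (H i)) = sum (tree_dist (H i) (S i)) (?V i)"
      using finH[OF i] by (simp add: sum.remove[of _ "groot (H i)"])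
    moreover have "real (card (?V i)) = real (card (verts (H i))) - 1"
      using card_Suc_Diff1[OF finH(1)[OF i] finH(3)[OF i]] by linarith
    ultimately show ?thesis by (simp add: cost_tree_dist sum.distrib)
  qed
  then have "(\<Sum>i=1..n. sum (\<tau> (H i)) (S i) +
        (\<Sum>w\<in>?V i. tree_dist G T (v i) + tree_dist (H i) (S i) w)) =
      (\<Sum>i=1..n. cost (H i) (S i) + tree_dist G T (v i) * (real (card (verts (H i))) - 1))"
    by (intro sum.cong) auto
  ultimately show ?thesis
    by (simp only: cost_tree_dist[of W] cost_tree_dist[of G] sum.distrib)
qed

end

end

section \<open>Spanning trees of rooted cycles\<close>

lemma L_sum_list: "L G p = sum_list (map (\<gamma> G) p)"
  by (simp add: L_def sum_list_sum_nth atLeast0LessThan)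

lemma L_append: "L G (p @ q) = L G p + L G q"
  by (simp add: L_sum_list)

lemma L_rev: "L G (rev p) = L G p"
  by (simp add: L_sum_list flip: rev_map)

text \<open>\<open>C\<close> adds up the distances from the start of the path to all of its
  vertices. The term \<open>k = 0\<close> vanishes, but including it gives one term per
  vertex.\<close>

lemma C_prefix_sum: "C G p = (\<Sum>k\<le>length p. L G (take k p))"
proof -
  have "C G p = (\<Sum>i<length p. L G (take (Suc i) p))"
    unfolding C_def L_def by (intro sum.cong) (auto split: if_splits simp: min_def)
  also have "\<dots> = (\<Sum>k\<le>length p. L G (take k p))"
    by (subst lessThan_Suc_atMost[symmetric], subst sum.lessThan_Suc_shift) (simp add: L_def)
  finally show ?thesis .
qed

text \<open>The cost sums over the set of edges of a path and \<open>L\<close> over the list; they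
  agree because a path repeats no edge.\<close>

lemma tree_dist_L:
  assumes "rooted_graph G" "spanning_tree G T" "path G (groot G) p w" "set p \<subseteq> T"
  shows "tree_dist G T w = L G p"
  using tree_path_eqI[OF assms] path_distinct[OF assms(3)]
  by (simp add: tree_dist_def L_sum_list sum_list_distinct_conv_sum_set)

text \<open>Both \<open>THE\<close> terms have the same defining predicate, so R_i is simply the
  tree path in \<open>G\<close> minus the i-th edge.\<close>

lemma path_avoiding_tree_path: "path_avoiding G e w = tree_path G (edges G - {e}) w"
proof -
  have "path G u p w \<and> e \<notin> set p \<longleftrightarrow> path (G\<lparr>edges := edges G - {e}\<rparr>) u p w" for u p
    by (subst path_edges_update) (auto simp: path_def)
  then show ?thesis by (simp add: path_avoiding_def tree_path_def)
qed

lemma L_path_avoiding: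
  assumes "rooted_graph G" "spanning_tree G (edges G - {e})" "w \<in> verts G"
  shows "L G (path_avoiding G e w) = tree_dist G (edges G - {e}) w"
  using tree_dist_L[OF assms(1,2) tree_path_works[OF assms]] by (simp add: path_avoiding_tree_path)

lemma path_snocE:
  assumes "path G u (p @ [e]) w"
  obtains x where "path G u p x" "ends G e = {x, w}"
proof -
  from path_rev[OF assms] obtain xs where xs: "path_via G xs (e # rev p)" "hd xs = w" "last xs = u"
    by (auto simp: path_iff_via)
  from xs(1) obtain ys where ys: "xs = w # ys" "ends G e = {w, hd ys}" "path_via G ys (rev p)" "ys \<noteq> []"
    by (rule path_via_ConsE) (use xs(2) in auto)
  then have "path G (hd ys) (rev p) u" using xs(3) by (auto simp: path_iff_via)
  from path_rev[OF this] ys(2) that show thesis by (auto simp: insert_commute)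
qed

text \<open>The far endpoint of an arm is not prescribed, so uniqueness of paths is applied after
  splitting off the last edge \<open>e\<close>. If two candidates enter \<open>e\<close> from the
  same side, their initial parts agree; opposite sides are impossible.\<close>

lemma arm_eqI:
  assumes f: "forest G (edges G - {e'})"
    and p: "path G (groot G) p w" "p \<noteq> []" "last p = e" "e' \<notin> set p"
  shows "arm G e e' = p"
  unfolding arm_def
proof (rule the_equality)
  fix q assume "q \<noteq> [] \<and> last q = e \<and> e' \<notin> set q \<and> (\<exists>w. path G (groot G) q w)"
  then obtain w' where q: "path G (groot G) q w'" "q \<noteq> []" "last q = e" "e' \<notin> set q" by auto
  note unique = path_unique[OF f, of "groot G"]
  have sub: "set r \<subseteq> edges G - {e'}" if "path G u r x" "e' \<notin> set r" for u r x
    using that by (auto simp: path_def)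
  define p' q' where "p' = butlast p" and "q' = butlast q"
  with p q have pq: "p = p' @ [e]" "q = q' @ [e]" by (metis append_butlast_last_id)+
  obtain x where x: "path G (groot G) p' x" "ends G e = {x, w}"
    using p(1) unfolding pq by (rule path_snocE)
  obtain y where y: "path G (groot G) q' y" "ends G e = {y, w'}"
    using q(1) unfolding pq by (rule path_snocE)
  show "q = p"
  proof (cases "x = y")
    case True
    have "p' = q'" using x(1) y(1) True p(4) q(4) pq by (intro unique[of p' x q'] sub) auto
    then show ?thesis using pq by simp
  next
    case False
    \<comment> \<open>Entering \<open>e\<close> from the other side means that \<open>q'\<close>
      already ends at \<open>w\<close>. It then equals \<open>p\<close> and contains
      \<open>e\<close>, so \<open>q\<close> would use \<open>e\<close> twice.\<close>
    then have "y = w" using x(2) y(2) by (auto simp: doubleton_eq_iff)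
    then have "q' = p" using p y(1) q(4) pq by (intro unique[of q' w p] sub) auto
    then show ?thesis using path_distinct[OF q(1)] pq by simp
  qed
qed (use p in auto)

lemma cycle_in_rotate:
  assumes "cycle_in G xs fs"
  shows "cycle_in G (rotate m xs) (rotate m fs)"
proof -
  let ?N = "length xs"
  from assms have *: "xs \<noteq> []" "length fs = ?N" "distinct xs" "distinct fs"
     "set xs \<subseteq> verts G" "set fs \<subseteq> edges G"
     "\<And>i. i < ?N \<Longrightarrow> ends G (fs ! i) = {xs ! i, xs ! (Suc i mod ?N)}"
    by (auto simp: cycle_in_def)
  have "ends G (rotate m fs ! i) = {rotate m xs ! i, rotate m xs ! (Suc i mod ?N)}"
    if i: "i < ?N" for i
  proof -
    have "rotate m xs ! (Suc i mod ?N) = xs ! (Suc ((m + i) mod ?N) mod ?N)"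
      using *(1) by (simp add: nth_rotate mod_simps)
    then show ?thesis using i * by (simp add: nth_rotate)
  qed
  then show ?thesis using * by (simp add: cycle_in_def)
qed

text \<open>Reversal shifts edges against vertices by one: \<open>rev xs\<close> goes with
  \<open>rotate1 (rev fs)\<close>. Rotating by \<open>length xs - 1\<close> completes a full turn of
  the edges and brings the original first vertex, last in \<open>rev xs\<close>, back to the front,
  so the root keeps its position.\<close>

lemma cycle_in_rev:
  assumes "cycle_in G xs fs"
  shows "cycle_in G (rotate (length xs - 1) (rev xs)) (rev fs)"
proof -
  from assms have *: "xs \<noteq> []" "length fs = length xs" "distinct fs" "set fs \<subseteq> edges G"
    by (auto simp: cycle_in_def)
  then have ne: "fs \<noteq> []" by auto
  have fs: "fs = butlast fs @ [last fs]" using ne by simp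
  then have "last fs \<notin> set (butlast fs)" using *(3)
    by (metis distinct_append distinct.simps(2) disjoint_iff list.set_intros(1))
  moreover have "last fs \<in> edges G" using ne * by auto
  ultimately have "cycle_in G (rev xs) (rev (butlast fs) @ [last fs])"
    using cycle_in_path_via[OF assms] *(1)
    by (intro path_via_cycle_in path_via_rev) (auto simp: hd_rev last_rev insert_commute)
  from cycle_in_rotate[OF this, of "length xs - 1"]
  have "cycle_in G (rotate (length xs - 1) (rev xs)) (rotate (length xs - 1) (rev (butlast fs) @ [last fs]))" .
  moreover have "rev (butlast fs) @ [last fs] = rotate1 (rev fs)"
    by (subst (3) fs) simp
  moreover have "rotate (length xs - 1) (rotate1 (rev fs)) = rotate (length xs) (rev fs)"
    using *(1) by (metis Suc_diff_1 length_greater_0_conv rotate1_rotate_swap rotate_Suc)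
  ultimately show ?thesis using *(2) by simp
qed

section \<open>The cycle enumerated from its root\<close>

locale rooted_cycle =
  fixes G :: "('v, 'e) rgraph" and xs :: "'v list" and fs :: "'e list"
  assumes rooted: "rooted_graph G" and cycle: "cycle_in G xs fs"
    and verts_G: "verts G = set xs" and edges_G: "edges G = set fs"
    and hd_xs: "hd xs = groot G"

lemma rooted_cycle_exists:
  assumes "rooted_graph G" "cycle_graph G"
  shows "\<exists>xs fs. rooted_cycle G xs fs"
proof -
  from assms(2) obtain xs fs where *: "cycle_in G xs fs" "verts G = set xs" "edges G = set fs"
    by (auto simp: cycle_graph_def)
  have "groot G \<in> set xs" using assms(1) * by (auto simp: rooted_graph_def)
  then obtain m where m: "m < length xs" "xs ! m = groot G" by (auto simp: in_set_conv_nth)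
  then have "hd (rotate m xs) = groot G" by (subst hd_rotate_conv_nth) auto
  then have "rooted_cycle G (rotate m xs) (rotate m fs)"
    using assms(1) * cycle_in_rotate[OF *(1)] by unfold_locales auto
  then show ?thesis by blast
qed

context rooted_cycle
begin

abbreviation N where "N \<equiv> length xs"

lemma cycle_facts:
  "xs \<noteq> []" "length fs = N" "distinct xs" "distinct fs"
  "i < N \<Longrightarrow> ends G (fs ! i) = {xs ! i, xs ! (Suc i mod N)}"
  using cycle by (auto simp: cycle_in_def)

lemma root_nth: "groot G = xs ! 0"
  using hd_xs cycle_facts(1) by (simp add: hd_conv_nth)

lemma rooted_cycle_rev: "rooted_cycle G (rotate (N - 1) (rev xs)) (rev fs)"
proof
  show "cycle_in G (rotate (N - 1) (rev xs)) (rev fs)" using cycle_in_rev[OF cycle] .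
  show "hd (rotate (N - 1) (rev xs)) = groot G"
    using cycle_facts(1) by (subst hd_rotate_conv_nth) (auto simp: rev_nth root_nth)
qed (use rooted verts_G edges_G in auto)

text \<open>For \<open>a < b\<close> this is the arc cut off from the root by the edges at positions
  \<open>a\<close> and \<open>b\<close>, since edge \<open>k\<close> follows vertex
  \<open>k\<close>. Position 0 never belongs to it.\<close>

definition segment :: "nat \<Rightarrow> nat \<Rightarrow> 'v set" where
  "segment a b = (!) xs ` {a<..b}"

lemma nth_mem_segment: "k < N \<Longrightarrow> b < N \<Longrightarrow> xs ! k \<in> segment a b \<longleftrightarrow> a < k \<and> k \<le> b"
  unfolding segment_def using cycle_facts(3) by (auto simp: nth_eq_iff_index_eq)

text \<open>The only edges leaving an arc are the two that bound it. The closing edge fits in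
  because it leads to position 0, which is outside; hence \<open>b = N - 1\<close> is no
  exception.\<close>

lemma edge_segment:
  assumes "i < N" "b < N" "ends G (fs ! i) = {x, y}"
  shows "(x \<in> segment a b \<longleftrightarrow> y \<in> segment a b) \<longleftrightarrow> a \<ge> b \<or> i \<noteq> a \<and> i \<noteq> b"
proof -
  have "Suc i mod N < N" using assms(1) by (intro mod_less_divisor) linarith
  then have "(xs ! i \<in> segment a b \<longleftrightarrow> xs ! (Suc i mod N) \<in> segment a b) \<longleftrightarrow>
     (a < i \<and> i \<le> b \<longleftrightarrow> a < Suc i mod N \<and> Suc i mod N \<le> b)"
    using assms nth_mem_segment by simp
  also have "\<dots> \<longleftrightarrow> a \<ge> b \<or> i \<noteq> a \<and> i \<noteq> b"
    using assms(1,2) by (cases "Suc i = N") auto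
  finally show ?thesis using assms cycle_facts(5)[OF assms(1)] by (auto simp: doubleton_eq_iff)
qed

lemma reach_segment:
  assumes "a < N" "b < N" "(x, y) \<in> (adj G (edges G - {fs ! a, fs ! b}))\<^sup>*"
  shows "x \<in> segment a b \<longleftrightarrow> y \<in> segment a b"
  using assms(3)
proof induction
  case (step y z)
  then obtain e where "e \<in> edges G" "e \<noteq> fs ! a" "e \<noteq> fs ! b" "ends G e = {y, z}"
    by (auto simp: adj_def)
  moreover from this obtain i where "i < N" "e = fs ! i"
    using cycle_facts(2) by (auto simp: edges_G in_set_conv_nth)
  ultimately have "y \<in> segment a b \<longleftrightarrow> z \<in> segment a b"
    using edge_segment[of i b y z a] assms(2) by auto
  with step.IH show ?case by blast
qed simp

text \<open>Once edge \<open>i\<close> is gone, any other edge \<open>j\<close> is a bridge: its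
  ends lie on different sides of the arc between \<open>i\<close> and \<open>j\<close>, and no
  remaining edge crosses.\<close>

lemma forest_delete:
  assumes "i < N"
  shows "forest G (edges G - {fs ! i})"
  unfolding forest_def
proof (intro ballI allI impI notI)
  fix e x y
  assume e: "e \<in> edges G - {fs ! i}" "ends G e = {x, y}"
    and r: "(x, y) \<in> (adj G (edges G - {fs ! i} - {e}))\<^sup>*"
  from e(1) obtain j where j: "j < N" "e = fs ! j" "j \<noteq> i"
    using cycle_facts(2) by (auto simp: edges_G in_set_conv_nth)
  have D: "edges G - {fs ! i} - {e} = edges G - {fs ! min i j, fs ! max i j}"
    using j by (auto simp: min_def max_def)
  have "x \<in> segment (min i j) (max i j) \<longleftrightarrow> y \<in> segment (min i j) (max i j)"
    using r assms j unfolding D by (intro reach_segment) auto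
  then show False using edge_segment[of j "max i j" x y "min i j"] e j assms by auto
qed

lemma path_via_butlast: "path_via G xs (butlast fs)"
  using cycle_in_path_via[OF cycle] by blast

lemma take_butlast_fs: "k < N \<Longrightarrow> take k (butlast fs) = take k fs"
  using cycle_facts(2) by (simp add: take_butlast)

lemma path_forward:
  assumes "k < N"
  shows "path G (groot G) (take k fs) (xs ! k)"
proof -
  have "path_via G (take (Suc k) xs) (take k fs)"
    using path_via_take[OF path_via_butlast, of k] assms cycle_facts(2)
    by (simp add: take_butlast_fs)
  moreover have "hd (take (Suc k) xs) = groot G" using hd_xs by (simp add: hd_take)
  moreover have "last (take (Suc k) xs) = xs ! k" using assms by (simp add: take_Suc_conv_app_nth)
  ultimately show ?thesis unfolding path_iff_via by blast
qed

text \<open>The closing edge returns to position 0, which is missing from \<open>drop k xs\<close>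
  when \<open>0 < k\<close>. The root is therefore put in front separately, followed by the reversed
  tail of the cycle cut open at that edge.\<close>

lemma path_backward:
  assumes "0 < k" "k < N"
  shows "path G (groot G) (rev (drop k fs)) (xs ! k)"
proof -
  have ne: "fs \<noteq> []" "drop k fs \<noteq> []" using assms cycle_facts by auto
  have "path_via G (drop k xs) (butlast (drop k fs))"
    using path_via_drop[OF path_via_butlast, of k] assms cycle_facts(2) by (simp add: drop_butlast)
  then have "path_via G (rev (drop k xs)) (rev (butlast (drop k fs)))" by (rule path_via_rev)
  moreover have "groot G \<notin> set (drop k xs)"
    using assms cycle_facts(1,3) by (auto simp: root_nth in_set_conv_nth nth_eq_iff_index_eq)
  moreover have "ends G (last fs) = {groot G, hd (rev (drop k xs))}"
    using cycle_in_path_via(2)[OF cycle] hd_xs assms by (simp add: hd_rev insert_commute)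
  moreover have "groot G \<in> verts G" using rooted by (simp add: rooted_graph_def)
  moreover have "last fs \<in> edges G" using ne by (simp add: edges_G)
  ultimately have "path_via G (groot G # rev (drop k xs)) (last fs # rev (butlast (drop k fs)))"
    by (simp add: path_via_Cons)
  moreover have "last fs # rev (butlast (drop k fs)) = rev (drop k fs)"
  proof -
    have "last fs # rev (butlast (drop k fs)) = rev (butlast (drop k fs) @ [last fs])" by simp
    also have "butlast (drop k fs) @ [last fs] = drop k fs"
      using assms cycle_facts(2) append_butlast_last_id[OF ne(2)] by simp
    finally show ?thesis .
  qed
  moreover have "last (groot G # rev (drop k xs)) = xs ! k"
    using assms by (simp add: last_rev hd_drop_conv_nth)
  ultimately show ?thesis unfolding path_iff_via
    by (intro exI[of _ "groot G # rev (drop k xs)"]) auto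
qed

lemma nth_notin_take: "i < N \<Longrightarrow> k \<le> i \<Longrightarrow> fs ! i \<notin> set (take k fs)"
  using cycle_facts(2,4) by (auto simp: in_set_conv_nth nth_eq_iff_index_eq)

lemma nth_notin_drop: "i < k \<Longrightarrow> k < N \<Longrightarrow> fs ! i \<notin> set (drop k fs)"
  using cycle_facts(2,4) by (auto simp: in_set_conv_nth nth_eq_iff_index_eq)

lemma take_subset_edges: "set (take k fs) \<subseteq> edges G"
  using set_take_subset by (fastforce simp: edges_G)

lemma drop_subset_edges: "set (drop k fs) \<subseteq> edges G"
  using set_drop_subset by (fastforce simp: edges_G)

lemma spanning_tree_delete:
  assumes "i < N"
  shows "spanning_tree G (edges G - {fs ! i})"
  unfolding spanning_tree_iff[OF rooted]
proof (intro conjI ballI)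
  fix w assume "w \<in> verts G"
  then obtain k where k: "k < N" "w = xs ! k" by (auto simp: verts_G in_set_conv_nth)
  show "(groot G, w) \<in> (adj G (edges G - {fs ! i}))\<^sup>*"
  proof (cases "k \<le> i")
    case True
    then show ?thesis using path_reach[OF path_forward[OF k(1)]] k take_subset_edges nth_notin_take[OF assms True]
      by (auto elim!: reach_mono)
  next
    case False
    then show ?thesis using path_reach[OF path_backward[OF _ k(1)]] k drop_subset_edges nth_notin_drop[of i k]
      by (auto elim!: reach_mono)
  qed
qed (use forest_delete[OF assms] in auto)

lemma tree_dist_delete:
  assumes "i < N" "k < N"
  shows "tree_dist G (edges G - {fs ! i}) (xs ! k) =
    (if k \<le> i then L G (take k fs) else L G (drop k fs))"
proof (cases "k \<le> i")
  case True
  have "tree_dist G (edges G - {fs ! i}) (xs ! k) = L G (take k fs)"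
    using take_subset_edges nth_notin_take[OF assms(1) True]
    by (intro tree_dist_L rooted spanning_tree_delete path_forward assms) auto
  then show ?thesis using True by simp
next
  case False
  have "tree_dist G (edges G - {fs ! i}) (xs ! k) = L G (rev (drop k fs))"
    using drop_subset_edges nth_notin_drop[of i k] False assms
    by (intro tree_dist_L rooted spanning_tree_delete path_backward assms) auto
  then show ?thesis using False by (simp add: L_rev)
qed

text \<open>Some edge is missing because all edges together form a cycle. A second missing edge
  would separate the arc between the two from the root.\<close>

lemma spanning_tree_cases:
  assumes "spanning_tree G T"
  obtains i where "i < N" "T = edges G - {fs ! i}"
proof -
  from assms have T: "T \<subseteq> edges G" "forest G T" "\<And>w. w \<in> verts G \<Longrightarrow> (groot G, w) \<in> (adj G T)\<^sup>*"
    by (auto simp: spanning_tree_iff[OF rooted])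
  have "T \<noteq> edges G" using T(2) cycle forest_iff_no_cycle[OF rooted] by blast
  with T(1) obtain e where "e \<in> edges G" "e \<notin> T" by blast
  then obtain i where i: "i < N" "fs ! i \<notin> T"
    using cycle_facts(2) by (auto simp: edges_G in_set_conv_nth)
  have "fs ! j \<in> T" if j: "j < N" "j \<noteq> i" for j
  proof (rule ccontr)
    assume "fs ! j \<notin> T"
    define a b where "a = min i j" and "b = max i j"
    have ab: "a < b" "b < N" "a < N" using i j by (auto simp: a_def b_def)
    have "T \<subseteq> edges G - {fs ! a, fs ! b}"
      using T(1) i(2) \<open>fs ! j \<notin> T\<close> by (auto simp: a_def b_def min_def max_def)
    moreover have "(groot G, xs ! b) \<in> (adj G T)\<^sup>*" using T(3) ab by (simp add: verts_G)
    ultimately have "(groot G, xs ! b) \<in> (adj G (edges G - {fs ! a, fs ! b}))\<^sup>*"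
      using reach_mono by metis
    from reach_segment[OF ab(3,2) this] show False
      using ab nth_mem_segment[of b b a] nth_mem_segment[of 0 b a] cycle_facts(1) by (simp add: root_nth)
  qed
  then have "edges G - {fs ! i} \<subseteq> T"
    using cycle_facts(2) by (metis DiffE edges_G in_set_conv_nth insertI1 subsetI)
  with i T(1) have "T = edges G - {fs ! i}" by blast
  with i that show thesis by blast
qed

section \<open>Two deleted edges of the cycle and the arc between them\<close>

context
  fixes a b :: nat
  assumes ab: "a < b" "b < N"
begin

text \<open>From here on \<open>fs ! b\<close> plays the role of e1 and \<open>fs ! a\<close> that
  of e2, so P_2 and Q+ run forward and P_1 runs backward. Vertices before the arc are reached
  forward, those after it backward, and \<open>reach_segment\<close> bars the arc itself.\<close>

lemma Q_verts_segment: "Q_verts G (fs ! b) (fs ! a) = segment a b"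
proof -
  let ?D = "edges G - {fs ! b, fs ! a}"
  have D: "path (delete_edges G {fs ! b, fs ! a}) u p w \<longleftrightarrow> path G u p w \<and> set p \<subseteq> ?D" for u p w
    unfolding delete_edges_def by (rule path_edges_update) auto
  have reach: "(\<exists>p. path G (groot G) p (xs ! k) \<and> set p \<subseteq> ?D) \<longleftrightarrow> \<not> (a < k \<and> k \<le> b)" if k: "k < N" for k
  proof
    assume "\<exists>p. path G (groot G) p (xs ! k) \<and> set p \<subseteq> ?D"
    then have "(groot G, xs ! k) \<in> (adj G (edges G - {fs ! a, fs ! b}))\<^sup>*"
      using path_reach reach_mono by (metis insert_commute)
    from reach_segment[OF _ _ this] show "\<not> (a < k \<and> k \<le> b)"
      using ab k nth_mem_segment[of k b a] nth_mem_segment[of 0 b a] cycle_facts(1) by (simp add: root_nth)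
  next
    assume "\<not> (a < k \<and> k \<le> b)"
    then consider "k \<le> a" | "b < k" by linarith
    then show "\<exists>p. path G (groot G) p (xs ! k) \<and> set p \<subseteq> ?D"
    proof cases
      case 1
      then show ?thesis using path_forward[OF k] take_subset_edges ab
          nth_notin_take[of a k] nth_notin_take[of b k] by (intro exI[of _ "take k fs"]) auto
    next
      case 2
      then show ?thesis using path_backward[OF _ k] drop_subset_edges ab k
          nth_notin_drop[of a k] nth_notin_drop[of b k] by (intro exI[of _ "rev (drop k fs)"]) auto
    qed
  qed
  have nth: "xs ! k \<in> Q_verts G (fs ! b) (fs ! a) \<longleftrightarrow> xs ! k \<in> segment a b" if "k < N" for k
  proof -
    have "xs ! k \<in> verts G" using that by (simp add: verts_G)
    then show ?thesis using reach[OF that] nth_mem_segment[OF that ab(2), of a]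
      unfolding Q_verts_def D by blast
  qed
  have "Q_verts G (fs ! b) (fs ! a) \<subseteq> set xs" "segment a b \<subseteq> set xs"
    using ab by (auto simp: Q_verts_def segment_def verts_G)
  then have "w \<in> Q_verts G (fs ! b) (fs ! a) \<longleftrightarrow> w \<in> segment a b" for w
    using nth in_set_conv_nth[of w xs] by blast
  then show ?thesis by blast
qed

lemma arm_first: "arm G (fs ! a) (fs ! b) = take (Suc a) fs"
proof (rule arm_eqI)
  show "path G (groot G) (take (Suc a) fs) (xs ! Suc a)" using path_forward ab by simp
  show "forest G (edges G - {fs ! b})" using forest_delete ab by simp
  show "fs ! b \<notin> set (take (Suc a) fs)" using nth_notin_take ab by simp
qed (use ab cycle_facts(2) in \<open>auto simp: take_Suc_conv_app_nth\<close>)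

lemma arm_second: "arm G (fs ! b) (fs ! a) = rev (drop b fs)"
proof (rule arm_eqI)
  show "path G (groot G) (rev (drop b fs)) (xs ! b)" using path_backward ab by simp
  show "forest G (edges G - {fs ! a})" using forest_delete ab by simp
  show "fs ! a \<notin> set (rev (drop b fs))" using nth_notin_drop ab by simp
qed (use ab cycle_facts(2) in \<open>auto simp: last_rev hd_drop_conv_nth\<close>)

text \<open>The list is empty for \<open>b = Suc a\<close>, the case in which Q is a single
  vertex.\<close>

definition middle :: "'e list" where "middle = drop (Suc a) (take b fs)"

lemma path_middle: "path G (xs ! Suc a) middle (xs ! b)" "set middle \<subseteq> edges G - {fs ! b, fs ! a}"
proof -
  have "path_via G (take (Suc b) xs) (take b fs)"
    using path_via_take[OF path_via_butlast, of b] ab cycle_facts(2) by (simp add: take_butlast_fs)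
  from path_via_drop[OF this, of "Suc a"]
  have "path_via G (drop (Suc a) (take (Suc b) xs)) middle"
    using ab cycle_facts(2) by (simp add: middle_def)
  moreover have "hd (drop (Suc a) (take (Suc b) xs)) = xs ! Suc a"
    using ab by (simp add: hd_drop_conv_nth)
  moreover have "last (drop (Suc a) (take (Suc b) xs)) = xs ! b"
    using ab by (simp add: last_conv_nth)
  ultimately show "path G (xs ! Suc a) middle (xs ! b)" unfolding path_iff_via by blast
  have "fs ! a \<notin> set middle" "fs ! b \<notin> set middle"
    using ab cycle_facts(2,4) by (auto simp: middle_def in_set_conv_nth nth_eq_iff_index_eq)
  moreover have "set middle \<subseteq> set fs"
    by (auto simp: middle_def dest: in_set_dropD in_set_takeD)
  ultimately show "set middle \<subseteq> edges G - {fs ! b, fs ! a}" by (auto simp: edges_G)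
qed

lemma Q_plus_middle: "Q_plus G (fs ! b) (fs ! a) = middle"
proof -
  let ?D = "edges G - {fs ! b, fs ! a}"
  have D: "path (delete_edges G {fs ! b, fs ! a}) u p w \<longleftrightarrow> path G u p w \<and> set p \<subseteq> ?D" for u p w
    unfolding delete_edges_def by (rule path_edges_update) auto
  \<comment> \<open>The second end of \<open>fs ! b\<close> may wrap around to the root. It lies
    outside the arc in any case, so each deleted edge has exactly one end in Q and both endpoints of
    \<open>Q_plus\<close> are forced.\<close>
  have "xs ! (Suc b mod N) \<notin> segment a b"
    using ab nth_mem_segment[OF _ ab(2), of "Suc b mod N" a] cycle_facts(1) by (cases "Suc b = N") auto
  then have x: "Q_verts G (fs ! b) (fs ! a) \<inter> ends G (fs ! a) = {xs ! Suc a}"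
    and y: "Q_verts G (fs ! b) (fs ! a) \<inter> ends G (fs ! b) = {xs ! b}"
    using ab nth_mem_segment[OF _ ab(2), of _ a]
    by (simp_all add: Q_verts_segment cycle_facts(5))
  have f: "forest G ?D" using forest_delete[OF ab(2)] by (rule forest_mono) auto
  show ?thesis unfolding Q_plus_def D x y
  proof (rule the_equality)
    fix q assume "\<exists>x\<in>{xs ! Suc a}. \<exists>y\<in>{xs ! b}. path G x q y \<and> set q \<subseteq> ?D"
    then have "path G (xs ! Suc a) q (xs ! b)" "set q \<subseteq> ?D" by auto
    then show "q = middle" using path_unique[OF f] path_middle by blast
  qed (use path_middle in auto)
qed

text \<open>Off the arc both trees leave the root in the same direction: forward up to
  \<open>a\<close>, backward beyond \<open>b\<close>.\<close>

lemma tree_dist_outside_Q: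
  assumes "w \<in> verts G" "w \<notin> Q_verts G (fs ! b) (fs ! a)"
  shows "tree_dist G (edges G - {fs ! b}) w = tree_dist G (edges G - {fs ! a}) w"
proof -
  from assms(1) obtain k where k: "k < N" "w = xs ! k" by (auto simp: verts_G in_set_conv_nth)
  with assms(2) have "\<not> (a < k \<and> k \<le> b)" using ab nth_mem_segment by (simp add: Q_verts_segment)
  then show ?thesis using k ab by (auto simp: tree_dist_delete)
qed

lemma cost_difference:
  "cost G (edges G - {fs ! b}) - cost G (edges G - {fs ! a}) =
     \<tau> G (fs ! a) - \<tau> G (fs ! b) +
     (L G (arm G (fs ! a) (fs ! b)) - L G (arm G (fs ! b) (fs ! a))) * (1 + real (length middle)) +
     C G middle - C G (rev middle)"
proof -
  define A B where "A = take (Suc a) fs" and "B = drop b fs"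
  let ?m = "length middle"
  let ?d1 = "tree_dist G (edges G - {fs ! b})" and ?d2 = "tree_dist G (edges G - {fs ! a})"
  have m: "Suc a + ?m = b" using ab cycle_facts(2) by (simp add: middle_def)
  have A: "length A = Suc a" using ab cycle_facts(2) by (simp add: A_def)
  have fs: "fs = A @ middle @ B"
  proof -
    have "A = take (Suc a) (take b fs)" using ab by (simp add: A_def min_def)
    then have "A @ middle = take b fs" unfolding middle_def by (simp only: append_take_drop_id)
    then have "(A @ middle) @ B = fs" unfolding B_def by (simp only: append_take_drop_id)
    then show ?thesis by simp
  qed
  have tau: "sum (\<tau> G) (edges G - {fs ! b}) - sum (\<tau> G) (edges G - {fs ! a}) = \<tau> G (fs ! a) - \<tau> G (fs ! b)"
    using ab cycle_facts(2) by (simp add: edges_G sum_diff1)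
  have "sum ?d1 (verts G) - sum ?d2 (verts G) = (\<Sum>w\<in>segment a b. ?d1 w - ?d2 w)"
    unfolding sum_subtractf[symmetric]
    using tree_dist_outside_Q ab
    by (intro sum.mono_neutral_right) (auto simp: verts_G Q_verts_segment segment_def)
  also have "\<dots> = (\<Sum>k\<in>{a<..b}. ?d1 (xs ! k) - ?d2 (xs ! k))"
    unfolding segment_def using ab cycle_facts(3)
    by (subst sum.reindex) (auto simp: inj_on_def nth_eq_iff_index_eq)
  also have "\<dots> = (\<Sum>k\<in>{a<..b}. L G (take k fs) - L G (drop k fs))"
    using ab by (intro sum.cong) (auto simp: tree_dist_delete)
  \<comment> \<open>Now \<open>j\<close> is the position on Q counted from its end at
    \<open>fs ! a\<close>. A path with \<open>?m\<close> edges has \<open>?m + 1\<close> vertices,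
    which is why L(P_2) - L(P_1) occurs in the hypothesis once alone and once with the factor
    |Q|.\<close>
  also have "\<dots> = (\<Sum>j\<le>?m. L G (take (Suc a + j) fs) - L G (drop (Suc a + j) fs))"
    by (rule sum.reindex_bij_witness[of _ "\<lambda>j. Suc a + j" "\<lambda>k. k - Suc a"]) (use m in auto)
  also have "\<dots> = (\<Sum>j\<le>?m. (L G A - L G B) + L G (take j middle) - L G (take (?m - j) (rev middle)))"
  proof (rule sum.cong)
    fix j assume "j \<in> {..?m}"
    have "take (Suc a + j) fs = A @ take j middle" "drop (Suc a + j) fs = drop j middle @ B"
      using A \<open>j \<in> {..?m}\<close> by (subst fs, simp)+
    \<comment> \<open>Seen from the far end, the remaining stretch of Q is a prefix of the reversed
      path, and \<open>L\<close> ignores the order of the edges.\<close>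
    moreover have "L G (take (?m - j) (rev middle)) = L G (drop j middle)"
      by (simp only: rev_drop[symmetric] L_rev)
    ultimately show "L G (take (Suc a + j) fs) - L G (drop (Suc a + j) fs) =
      (L G A - L G B) + L G (take j middle) - L G (take (?m - j) (rev middle))"
      by (simp add: L_append)
  qed simp
  also have "\<dots> = (L G A - L G B) * (1 + real ?m) + (\<Sum>j\<le>?m. L G (take j middle)) -
      (\<Sum>j\<le>?m. L G (take (?m - j) (rev middle)))"
    by (simp add: sum.distrib sum_subtractf algebra_simps)
  \<comment> \<open>Summing from the other end gives the form that \<open>C_prefix_sum\<close>
    recognises as \<open>C\<close> of the reversed path.\<close>
  also have "(\<Sum>j\<le>?m. L G (take (?m - j) (rev middle))) = (\<Sum>j\<le>?m. L G (take j (rev middle)))"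
    by (rule sum.reindex_bij_witness[of _ "\<lambda>j. ?m - j" "\<lambda>j. ?m - j"]) auto
  finally show ?thesis using tau
    by (simp add: cost_tree_dist arm_first arm_second L_rev C_prefix_sum A_def B_def)
qed

lemma cost_exchange:
  "cost G (edges G - {fs ! b}) - cost G (edges G - {fs ! a}) =
     \<tau> G (fs ! a) - \<tau> G (fs ! b) +
     (L G (arm G (fs ! a) (fs ! b)) - L G (arm G (fs ! b) (fs ! a))) *
       (1 + real (length (Q_plus G (fs ! b) (fs ! a)))) +
     C G (Q_plus G (fs ! b) (fs ! a)) - C G (Q_minus G (fs ! b) (fs ! a))"
  using cost_difference by (simp add: Q_plus_middle Q_minus_def)

end

end

text \<open>The cost difference is computed only for e2 at the smaller position. In the other case
  the cycle is enumerated backwards from the same root, which moves the edge at \<open>i\<close> to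
  \<open>N - Suc i\<close> and so exchanges the order.\<close>

lemma rooted_cycle_positions:
  assumes "rooted_graph G" "cycle_graph G" "e1 \<in> edges G" "e2 \<in> edges G" "e1 \<noteq> e2"
  obtains xs fs a b where "rooted_cycle G xs fs" "a < b" "b < length xs" "fs ! a = e2" "fs ! b = e1"
proof -
  obtain xs fs where c: "rooted_cycle G xs fs" using rooted_cycle_exists[OF assms(1,2)] by blast
  interpret rooted_cycle G xs fs by (fact c)
  obtain i j where ij: "i < N" "fs ! i = e2" "j < N" "fs ! j = e1"
    using assms(3,4) cycle_facts(2) by (auto simp: edges_G in_set_conv_nth)
  then consider "i < j" | "j < i" using assms(5) by force
  then show thesis
  proof cases
    case 1
    then show ?thesis using that[OF c 1] ij by blast
  next
    case 2
    have "rev fs ! (N - Suc i) = e2" "rev fs ! (N - Suc j) = e1"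
      using ij cycle_facts(2) by (auto simp: rev_nth)
    then show ?thesis
      using that[OF rooted_cycle_rev, of "N - Suc i" "N - Suc j"] 2 ij by auto
  qed
qed

theorem theorem1:
  fixes G :: "('v, 'e) rgraph"
    and e1 :: 'e
    and n :: nat
    and v :: "nat \<Rightarrow> 'v"
    and H :: "nat \<Rightarrow> ('w, 'f) rgraph"
    and S :: "nat \<Rightarrow> 'f set"
  assumes "rooted_graph G" and "cycle_graph G"
    and "e1 \<in> edges G"
    and "cable_trench_tree G (edges G - {e1})"
    and "inj_on v {1..n}"
    and "\<And>i. i \<in> {1..n} \<Longrightarrow> v i \<in> verts G \<and> v i \<noteq> groot G"
    and "\<And>i. i \<in> {1..n} \<Longrightarrow> rooted_graph (H i)"
    and "\<And>i. i \<in> {1..n} \<Longrightarrow> cable_trench_tree (H i) (S i)"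
    and "\<And>e2. e2 \<in> edges G \<Longrightarrow> e2 \<noteq> e1 \<Longrightarrow>
      0 \<ge> \<tau> G e2 - \<tau> G e1 + L G (arm G e2 e1) - L G (arm G e1 e2)
          + (L G (arm G e2 e1) - L G (arm G e1 e2)) * real (length (Q_plus G e1 e2))
          + C G (Q_plus G e1 e2) - C G (Q_minus G e1 e2)
          + (\<Sum>j | j \<in> {1..n} \<and> v j \<in> Q_verts G e1 e2.
               (L G (path_avoiding G e1 (v j)) - L G (path_avoiding G e2 (v j)))
                 * (real (card (verts (H j))) - 1))"
  shows "cable_trench_tree (wedge n G v H) (wedge_edges n (edges G - {e1}) S)"
proof -
  interpret W: rooted_wedge n G v H
    by unfold_locales (use assms(1,6,7) in auto)
  let ?D1 = "edges G - {e1}"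
  have T1: "spanning_tree G ?D1" using assms(4) by (simp add: cable_trench_tree_def)
  have S: "spanning_tree (H i) (S i)" if "i \<in> {1..n}" for i
    using assms(8)[OF that] by (simp add: cable_trench_tree_def)
  show ?thesis unfolding cable_trench_tree_def
  proof (intro conjI allI impI)
    show "spanning_tree W.W (wedge_edges n ?D1 S)" using T1 S by (simp add: W.spanning_tree_wedge)
    fix T' assume T': "spanning_tree W.W T'"
    define T S' where "T = Inl -` T'" and "S' = (\<lambda>i. {f. Inr (i, f) \<in> T'})"
    have T'_eq: "T' = wedge_edges n T S'"
      using W.wedge_edges_decomp[of T'] T' by (simp add: spanning_tree_def T_def S'_def)
    then have T: "spanning_tree G T" and S': "\<And>i. i \<in> {1..n} \<Longrightarrow> spanning_tree (H i) (S' i)"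
      using T' by (auto simp: W.spanning_tree_wedge)
    let ?c = "\<lambda>i. real (card (verts (H i))) - 1"
    have "(\<Sum>i=1..n. cost (H i) (S i)) \<le> (\<Sum>i=1..n. cost (H i) (S' i))"
      using assms(8) S' by (intro sum_mono) (auto simp: cable_trench_tree_def)
    \<comment> \<open>With the attached trees compared separately, each attaching vertex still
      weighs in with the number of vertices hanging on it. The inequality assumed for e2 controls
      exactly this weighted comparison.\<close>
    moreover have "cost G ?D1 + (\<Sum>i=1..n. tree_dist G ?D1 (v i) * ?c i) \<le>
        cost G T + (\<Sum>i=1..n. tree_dist G T (v i) * ?c i)"
    proof -
      obtain e2 where e2: "e2 \<in> edges G" "T = edges G - {e2}"
      proof -
        obtain xs fs where "rooted_cycle G xs fs" using rooted_cycle_exists[OF assms(1,2)] by blast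
        then interpret rooted_cycle G xs fs .
        from T obtain i where "i < N" "T = edges G - {fs ! i}" by (rule spanning_tree_cases)
        then show thesis using that[of "fs ! i"] cycle_facts(2) by (simp add: edges_G)
      qed
      show ?thesis
      proof (cases "e2 = e1")
        case False
        then obtain xs fs a b where c: "rooted_cycle G xs fs"
          and ab: "a < b" "b < length xs" "fs ! a = e2" "fs ! b = e1"
          using rooted_cycle_positions[OF assms(1-3) e2(1)] by metis
        interpret rooted_cycle G xs fs by (fact c)
        let ?Q = "Q_verts G e1 e2"
        have "(\<Sum>i=1..n. tree_dist G ?D1 (v i) * ?c i) - (\<Sum>i=1..n. tree_dist G T (v i) * ?c i) =
            (\<Sum>i=1..n. (tree_dist G ?D1 (v i) - tree_dist G T (v i)) * ?c i)"
          by (simp add: sum_subtractf left_diff_distrib)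
        \<comment> \<open>An attaching vertex off Q is equally far from the root in both trees, so
          its term is zero.\<close>
        also have "\<dots> = (\<Sum>j | j \<in> {1..n} \<and> v j \<in> ?Q. (tree_dist G ?D1 (v j) - tree_dist G T (v j)) * ?c j)"
          using tree_dist_outside_Q[OF ab(1,2)] assms(6) ab e2(2)
          by (intro sum.mono_neutral_right) auto
        \<comment> \<open>R_1 and R_2 are the tree paths in \<open>?D1\<close> and \<open>T\<close>,
          so their lengths are the two distances.\<close>
        also have "\<dots> = (\<Sum>j | j \<in> {1..n} \<and> v j \<in> ?Q.
               (L G (path_avoiding G e1 (v j)) - L G (path_avoiding G e2 (v j))) * ?c j)"
          using assms(1,6) T T1 e2(2) by (intro sum.cong) (auto simp: L_path_avoiding)
        finally show ?thesis
          using assms(9)[OF e2(1) False] cost_exchange[OF ab(1,2)] ab e2(2)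
          by (simp add: algebra_simps)
      qed (use e2 in simp)
    qed
    ultimately show "cost W.W (wedge_edges n ?D1 S) \<le> cost W.W T'"
      unfolding T'_eq using W.cost_wedge[OF T1 S] W.cost_wedge[OF T S'] by simp
  qed
qed

end
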